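(* There exist at least $\omega_1$ many pairwise non-homeomorphic $t$-sets that are regularly closed and compact subsets of $\mathbb R$; that is, there is a family of cardinality $\omega_1$ (the first uncountable cardinal) consisting of pairwise non-homeomorphic regularly closed compact subsets of $\mathbb R$, each of which is a $t$-set.
   Context: A copy of a set $A\subseteq\mathbb R$ is a set $Y\subseteq\mathbb R$ homeomorphic to $A$ (subspace topologies). A set $A\subseteq\mathbb R$ is a $t$-set (tame in $\mathbb R$) if for every copy $Y\subseteq\mathbb R$ of $A$ there exists a homeomorphism $f\colon\mathbb R\to\mathbb R$ such that $f[A]=Y$. A set $Y\subseteq\mathbb R$ is regularly closed if it is closed and the union of all its non-trivial (i.e. having more than one point) connected components is dense in $Y$. *)

theory Defs
  imports "HOL-Analysis.Analysis"
begin

definition t_set :: "real set \<Rightarrow> bool" where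
  "t_set A \<longleftrightarrow>
    (\<forall>Y. Y homeomorphic A \<longrightarrow>
      (\<exists>f g. homeomorphism (UNIV :: real set) (UNIV :: real set) f g \<and> f ` A = Y))"

(* The union of components lies in Y, so the inclusion in the closure (taken in the reals)
   says that this union is dense in Y. *)
definition regularly_closed :: "real set \<Rightarrow> bool" where
  "regularly_closed Y \<longleftrightarrow>
    closed Y \<and> Y \<subseteq> closure (\<Union>{C \<in> components Y. \<exists>x\<in>C. \<exists>y\<in>C. x \<noteq> y})"

end

theory Submission
  imports Defs
begin

text \<open>The sets are the compact sets all of whose components are non-trivial intervals and whose
  Cantor-Bendixson structure is as symmetric as possible: a set of rank \<open>\<alpha>\<close> has a main interval
  \<open>[a, b]\<close>, clopen pieces of every rank \<open>\<beta> < \<alpha>\<close> accumulate at each of its two ends, and away from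
  \<open>[a, b]\<close> the set is locally a clopen piece of lower rank. This description is invariant under
  homeomorphisms, and the rank is determined by the set.

  Because both ends of every component look the same, a homeomorphic copy that flips some components
  has the same order type. By induction on the rank, two sets of rank \<open>\<alpha>\<close> are related by an increasing
  bijection: a piece of rank \<open>\<beta>\<close> is absorbed by an adjacent piece of higher rank, so a one-sided tail
  at an end of the main interval has, for every \<open>\<beta> < \<alpha>\<close>, an outermost block of rank exactly \<open>\<beta>\<close>, and
  two tails are matched block by block, back and forth. An increasing bijection between compact sets
  extends to the line, affinely on the gaps. A set of rank \<open>\<alpha>\<close> exists whenever \<open>\<alpha>\<close> has
  countably many predecessors.\<close>


subsection \<open>Increasing bijections\<close>

text \<open>Continuity is not part of the relation: between compact sets an increasing bijection
  extends to an increasing surjection of the line, and such a map is a homeomorphism.\<close>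

definition order_iso_sets :: "real set \<Rightarrow> real set \<Rightarrow> bool" (infix "\<cong>\<^sub>o" 50) where
  "A \<cong>\<^sub>o B \<longleftrightarrow> (\<exists>f. strict_mono_on A f \<and> f ` A = B)"

definition precedes :: "real set \<Rightarrow> real set \<Rightarrow> bool" (infix "\<lless>" 50) where
  "A \<lless> B \<longleftrightarrow> (\<forall>x\<in>A. \<forall>y\<in>B. x < y)"

lemma order_iso_setsE:
  assumes "A \<cong>\<^sub>o B"
  obtains f where "strict_mono_on A f" "f ` A = B"
  using assms unfolding order_iso_sets_def by blast

lemma order_iso_sets_refl: "A \<cong>\<^sub>o A"
  unfolding order_iso_sets_def by (rule exI[of _ "\<lambda>x. x"]) (auto simp: strict_mono_on_def)

lemma order_iso_sets_sym:
  assumes "A \<cong>\<^sub>o B" shows "B \<cong>\<^sub>o A"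
proof -
  from assms obtain f where f: "strict_mono_on A f" "f ` A = B" by (rule order_iso_setsE)
  have inj: "inj_on f A" using f(1) by (rule strict_mono_on_imp_inj_on)
  have "strict_mono_on B (the_inv_into A f)"
    unfolding strict_mono_on_def f(2)[symmetric]
    by (auto simp: the_inv_into_f_f[OF inj] strict_mono_on_less[OF f(1)])
  moreover have "the_inv_into A f ` B = A"
    unfolding f(2)[symmetric] by (auto simp: image_image the_inv_into_f_f[OF inj])
  ultimately show ?thesis unfolding order_iso_sets_def by blast
qed

text \<open>The pieces are laid out in the same order on both sides and are pairwise disjoint, so a
  point determines its piece, and the piecewise maps glue to a map that increases within pieces and
  across them.\<close>

lemma order_iso_sets_UN:
  assumes iso: "\<And>i. i \<in> I \<Longrightarrow> A i \<cong>\<^sub>o B i"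
    and ord: "\<And>i j. i \<in> I \<Longrightarrow> j \<in> I \<Longrightarrow> i \<noteq> j \<Longrightarrow>
      (A i \<lless> A j \<and> B i \<lless> B j) \<or> (A j \<lless> A i \<and> B j \<lless> B i)"
  shows "(\<Union>i\<in>I. A i) \<cong>\<^sub>o (\<Union>i\<in>I. B i)"
proof -
  obtain g where g: "\<And>i. i \<in> I \<Longrightarrow> strict_mono_on (A i) (g i)" "\<And>i. i \<in> I \<Longrightarrow> g i ` A i = B i"
    using iso unfolding order_iso_sets_def by metis
  have uniq: "i = j" if "i \<in> I" "j \<in> I" "x \<in> A i" "x \<in> A j" for i j x
    using ord[of i j] that unfolding precedes_def by force
  define ix where "ix x = (SOME i. i \<in> I \<and> x \<in> A i)" for x
  have ix: "ix x = i" if "i \<in> I" "x \<in> A i" for i x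
    unfolding ix_def by (rule some_equality) (use that uniq in auto)
  define f where "f x = g (ix x) x" for x
  have fi: "f x = g i x" if "i \<in> I" "x \<in> A i" for i x
    using that by (simp add: f_def ix)
  have fB: "f x \<in> B i" if "i \<in> I" "x \<in> A i" for i x
    using that by (metis fi g(2) imageI)
  have "strict_mono_on (\<Union>i\<in>I. A i) f"
  proof (rule strict_mono_onI)
    fix x y assume "x \<in> (\<Union>i\<in>I. A i)" "y \<in> (\<Union>i\<in>I. A i)" and xy: "x < y"
    then obtain i j where ij: "i \<in> I" "x \<in> A i" "j \<in> I" "y \<in> A j" by auto
    show "f x < f y"
    proof (cases "i = j")
      case True
      then show ?thesis using ij g(1)[of i] xy by (auto simp: fi strict_mono_on_def)
    next
      case False
      then have "A i \<lless> A j \<and> B i \<lless> B j"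
        using ord[of i j] ij xy unfolding precedes_def by force
      then show ?thesis using fB ij unfolding precedes_def by blast
    qed
  qed
  moreover have "f ` (\<Union>i\<in>I. A i) = (\<Union>i\<in>I. B i)"
    unfolding image_UN by (rule SUP_cong) (auto simp: fi g(2)[symmetric])
  ultimately show ?thesis unfolding order_iso_sets_def by blast
qed

lemma order_iso_sets_Un:
  assumes "A \<cong>\<^sub>o B" "A' \<cong>\<^sub>o B'" "A \<lless> A'" "B \<lless> B'"
  shows "A \<union> A' \<cong>\<^sub>o B \<union> B'"
proof -
  have "(\<Union>i\<in>{False,True}. if i then A' else A) \<cong>\<^sub>o (\<Union>i\<in>{False,True}. if i then B' else B)"
    by (rule order_iso_sets_UN) (use assms in auto)
  then show ?thesis by (simp add: Un_commute)
qed

lemma order_iso_sets_uminus: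
  assumes "A \<cong>\<^sub>o B" shows "uminus ` A \<cong>\<^sub>o uminus ` B"
proof -
  from assms obtain f where f: "strict_mono_on A f" "f ` A = B" by (rule order_iso_setsE)
  have "strict_mono_on (uminus ` A) (\<lambda>x. - f (- x))" "(\<lambda>x. - f (- x)) ` uminus ` A = uminus ` B"
    using f by (auto simp: strict_mono_on_def image_image)
  then show ?thesis unfolding order_iso_sets_def by blast
qed

lemma order_iso_sets_cbox:
  fixes a b c d :: real
  assumes "a < b" "c < d" shows "{a..b} \<cong>\<^sub>o {c..d}"
proof -
  define r where "r = (d - c) / (b - a)"
  have "r * (b - a) = d - c" using assms by (simp add: r_def)
  then have r: "0 < r" "r * b - r * a = d - c"
    using assms by (auto simp: r_def right_diff_distrib)
  have "(\<lambda>x. r * x + (c - r * a)) ` {a..b} = {c..d}"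
    using assms r by (subst image_affinity_atLeastAtMost) (auto simp: algebra_simps)
  moreover have "strict_mono_on {a..b} (\<lambda>x. r * x + (c - r * a))"
    using r by (auto simp: strict_mono_on_def)
  ultimately show ?thesis unfolding order_iso_sets_def by blast
qed

section \<open>Extending increasing bijections to the line\<close>

text \<open>The extension is affine on every gap; a point of the closed set has both neighbours equal
  to itself, and there the quotient is \<open>0 / 0 = 0\<close>.\<close>

lemma strict_mono_extension_unbounded:
  fixes A B :: "real set"
  assumes A: "closed A" and B: "closed B"
    and f: "strict_mono_on A f" "f ` A = B"
    and unb: "\<And>x. \<exists>y\<in>A. y \<le> x" "\<And>x. \<exists>y\<in>A. x \<le> y" "\<And>x. \<exists>y\<in>B. y \<le> x" "\<And>x. \<exists>y\<in>B. x \<le> y"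
  shows "\<exists>g. strict_mono g \<and> surj g \<and> (\<forall>x\<in>A. g x = f x)"
proof -
  \<comment> \<open>\<open>lo S x\<close> and \<open>hi S x\<close> are the points of
    \<open>S\<close> nearest to \<open>x\<close> from below and from above; they exist because
    \<open>S\<close> is closed and unbounded in both directions.\<close>
  define lo where "lo S x = Sup (S \<inter> {..x})" for S :: "real set" and x
  define hi where "hi S x = Inf (S \<inter> {x..})" for S :: "real set" and x
  have lo: "lo S x \<in> S" "lo S x \<le> x" "\<And>z. z \<in> S \<Longrightarrow> z \<le> x \<Longrightarrow> z \<le> lo S x"
    if "closed S" "\<And>x. \<exists>y\<in>S. y \<le> x" for S x
  proof -
    have ne: "S \<inter> {..x} \<noteq> {}" using that(2)[of x] by auto
    have bd: "bdd_above (S \<inter> {..x})" by (rule bdd_aboveI[of _ x]) auto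
    have "lo S x \<in> S \<inter> {..x}" unfolding lo_def
      by (rule closed_contains_Sup[OF ne bd]) (use that(1) in \<open>auto intro: closed_Int\<close>)
    then show "lo S x \<in> S" "lo S x \<le> x" by auto
    show "\<And>z. z \<in> S \<Longrightarrow> z \<le> x \<Longrightarrow> z \<le> lo S x" unfolding lo_def
      by (rule cSup_upper[OF _ bd]) auto
  qed
  have hi: "hi S x \<in> S" "x \<le> hi S x" "\<And>z. z \<in> S \<Longrightarrow> x \<le> z \<Longrightarrow> hi S x \<le> z"
    if "closed S" "\<And>x. \<exists>y\<in>S. x \<le> y" for S x
  proof -
    have ne: "S \<inter> {x..} \<noteq> {}" using that(2)[of x] by auto
    have bd: "bdd_below (S \<inter> {x..})" by (rule bdd_belowI[of _ x]) auto
    have "hi S x \<in> S \<inter> {x..}" unfolding hi_def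
      by (rule closed_contains_Inf[OF ne bd]) (use that(1) in \<open>auto intro: closed_Int\<close>)
    then show "hi S x \<in> S" "x \<le> hi S x" by auto
    show "\<And>z. z \<in> S \<Longrightarrow> x \<le> z \<Longrightarrow> hi S x \<le> z" unfolding hi_def
      by (rule cInf_lower[OF _ bd]) auto
  qed
  note loA = lo[OF A unb(1)] and hiA = hi[OF A unb(2)]
    and loB = lo[OF B unb(3)] and hiB = hi[OF B unb(4)]
  have fless: "f x < f y \<longleftrightarrow> x < y" if "x \<in> A" "y \<in> A" for x y
    using strict_mono_on_less[OF f(1)] that by blast
  have fle: "f x \<le> f y \<longleftrightarrow> x \<le> y" if "x \<in> A" "y \<in> A" for x y
    using strict_mono_on_less_eq[OF f(1)] that by blast
  define g where "g x = f (lo A x) + (x - lo A x) / (hi A x - lo A x) * (f (hi A x) - f (lo A x))" for x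
  have loeq: "lo A x = x" "hi A x = x" if "x \<in> A" for x
    using that loA(3)[of x x] hiA(3)[of x x] loA(2)[of x] hiA(2)[of x] by auto
  have gf: "g x = f x" if "x \<in> A" for x
    using loeq[OF that] by (simp add: g_def)
  have strict: "f (lo A x) < g x \<and> g x < f (hi A x)" if "x \<notin> A" for x
  proof -
    have 1: "lo A x < x" "x < hi A x"
      using loA(1,2)[of x] hiA(1,2)[of x] that by (metis order_less_le)+
    then have 2: "0 < f (hi A x) - f (lo A x)" using fless[of "lo A x" "hi A x"] loA(1) hiA(1) by auto
    have 3: "0 < (x - lo A x) / (hi A x - lo A x)" "(x - lo A x) / (hi A x - lo A x) < 1"
      using 1 by (auto simp: field_simps)
    show ?thesis unfolding g_def using mult_pos_pos[OF 3(1) 2] mult_strict_right_mono[OF 3(2) 2, unfolded mult_1]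
      by (intro conjI) linarith+
  qed
  have weak: "f (lo A x) \<le> g x \<and> g x \<le> f (hi A x)" for x
    by (cases "x \<in> A") (use strict[of x] loeq[of x] gf[of x] in auto)
  have mono: "g x < g y" if xy: "x < y" for x y
  \<comment> \<open>Either some \<open>z\<close> of \<open>A\<close> lies between \<open>x\<close>
    and \<open>y\<close>, and \<open>f z\<close> lies between the values, or \<open>x\<close> and
    \<open>y\<close> lie in one gap, where \<open>g\<close> is affine with positive slope.\<close>
  proof (cases "\<exists>z\<in>A. x \<le> z \<and> z \<le> y")
    case True
    then obtain z where z: "z \<in> A" "x \<le> z" "z \<le> y" by blast
    have 1: "f (hi A x) \<le> f z" "f z \<le> f (lo A y)"
      using z hiA loA fle by auto
    show ?thesis
    proof (cases "x \<in> A \<and> y \<in> A")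
      case True then show ?thesis using gf fless xy by auto
    next
      case False
      then show ?thesis using 1 strict[of x] strict[of y] weak[of x] weak[of y] by fastforce
    qed
  next
    case False
    then have xA: "x \<notin> A" using xy by force
    have "lo A y \<le> x" "y \<le> hi A x" using False loA(1,2)[of y] hiA(1,2)[of x] by force+
    then have eq: "lo A y = lo A x" "hi A y = hi A x"
      using loA(1)[of y] loA(2)[of x] loA(3)[of "lo A y" x] loA(3)[of "lo A x" y] loA(1)[of x]
        hiA(1)[of x] hiA(1,2)[of y] hiA(3)[of "hi A x" y] hiA(3)[of "hi A y" x] xy
      by (auto intro: antisym)
    have 1: "lo A x < x" "x < hi A x"
      using loA(1,2)[of x] hiA(1,2)[of x] xA by (metis order_less_le)+
    then have 2: "0 < f (hi A x) - f (lo A x)" using fless[of "lo A x" "hi A x"] loA(1) hiA(1) by auto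
    have "(x - lo A x) / (hi A x - lo A x) < (y - lo A x) / (hi A x - lo A x)"
      using 1 xy by (intro divide_strict_right_mono) auto
    from mult_strict_right_mono[OF this 2] show ?thesis by (simp add: g_def eq)
  qed
  have "\<exists>x. g x = y" for y
  proof (cases "y \<in> B")
    case True then show ?thesis using gf f(2) by force
  next
    case False
    have y: "lo B y < y" "y < hi B y"
      using loB(1,2)[of y] hiB(1,2)[of y] False by (metis order_less_le)+
    obtain p q where pq: "p \<in> A" "q \<in> A" "f p = lo B y" "f q = hi B y"
      using loB(1)[of y] hiB(1)[of y] f(2) by (metis imageE)
    have "p < q" using fless[of p q] pq y by auto
    have gap: "z \<le> p \<or> q \<le> z" if "z \<in> A" for z
      using loB(3)[of "f z" y] hiB(3)[of "f z" y] fle that pq f(2) by (metis imageI linorder_le_cases)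
    \<comment> \<open>The gap of \<open>B\<close> around \<open>y\<close> corresponds to the gap of
      \<open>A\<close> between \<open>p\<close> and \<open>q\<close>; \<open>x\<close> divides the
      latter in the same ratio as \<open>y\<close> the former.\<close>
    define x where "x = p + (y - lo B y) / (hi B y - lo B y) * (q - p)"
    have r: "0 < (y - lo B y) / (hi B y - lo B y)" "(y - lo B y) / (hi B y - lo B y) < 1"
      using y by (auto simp: field_simps)
    have px: "p < x" "x < q"
      using mult_pos_pos[OF r(1), of "q - p"] mult_strict_right_mono[OF r(2), of "q - p", unfolded mult_1]
        \<open>p < q\<close> unfolding x_def by linarith+
    have "lo A x = p" "hi A x = q"
      using loA(1,2)[of x] loA(3)[of p x] hiA(1,2)[of x] hiA(3)[of q x] gap[of "lo A x"] gap[of "hi A x"] px pq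
      by auto
    then have "g x = y" using \<open>p < q\<close> y pq unfolding g_def
      by (simp add: x_def)
    then show ?thesis ..
  qed
  then have "surj g" by (metis surjI)
  moreover have "strict_mono g" using mono by (simp add: strict_mono_def)
  ultimately show ?thesis using gf by blast
qed

lemma strict_mono_surj_homeomorphism:
  fixes g :: "real \<Rightarrow> real"
  assumes "strict_mono g" "surj g"
  shows "homeomorphism UNIV UNIV g (inv g)"
proof -
  have inj: "inj g" using assms(1) by (rule strict_mono_imp_inj_on)
  have bij: "bij g" using inj assms(2) by (rule bijI)
  have c1: "continuous_on UNIV g"
    by (rule continuous_onI_mono) (use assms in \<open>auto dest: strict_mono_leD\<close>)
  have c2: "continuous_on UNIV (inv g)"
  proof (rule continuous_onI_mono)
    show "open (inv g ` UNIV)" using bij by (simp add: bij_imp_bij_inv bij_is_surj)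
    show "inv g x \<le> inv g y" if "x \<le> y" for x y
      using that strict_mono_less_eq[OF assms(1), of "inv g x" "inv g y"] assms(2) by (simp add: surj_f_inv_f)
  qed
  show ?thesis using c1 c2 bij
    by (auto simp: homeomorphism_def inv_f_f[OF inj] surj_f_inv_f[OF assms(2)] bij_is_surj bij_imp_bij_inv)
qed

lemma order_iso_sets_extension:
  assumes A: "compact A" and B: "compact B" and iso: "A \<cong>\<^sub>o B"
  obtains F :: "real \<Rightarrow> real" where "strict_mono F" "surj F" "F ` A = B"
proof (cases "A = {}")
  case True
  then have "B = {}" using iso by (auto simp: order_iso_sets_def)
  with True show ?thesis using that[of id] by (auto simp: strict_mono_def)
next
  case False
  from iso obtain f where f: "strict_mono_on A f" "f ` A = B" by (rule order_iso_setsE)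
  obtain m where m: "m \<in> A" "\<And>x. x \<in> A \<Longrightarrow> m \<le> x" using compact_attains_inf[OF A False] by blast
  obtain M where M: "M \<in> A" "\<And>x. x \<in> A \<Longrightarrow> x \<le> M" using compact_attains_sup[OF A False] by blast
  have fle: "f x \<le> f y \<longleftrightarrow> x \<le> y" if "x \<in> A" "y \<in> A" for x y
    using strict_mono_on_less_eq[OF f(1)] that by blast
  \<comment> \<open>Adding the two outer rays, which are moved by translations, makes both sets
    unbounded in both directions, as the extension lemma demands.\<close>
  define A' where "A' = ({..m} \<union> {M..}) \<union> A"
  define B' where "B' = ({..f m} \<union> {f M..}) \<union> B"
  define f' where "f' x = (if x < m then f m + (x - m) else if x > M then f M + (x - M) else f x)" for x
  have f'f: "f' x = f x" if "x \<in> A" for x using that m M by (force simp: f'_def)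
  have "strict_mono_on A' f'"
  proof (rule strict_mono_onI)
    fix x y assume xy: "x \<in> A'" "y \<in> A'" "x < y"
    have X: "x < m \<or> M < x \<or> x \<in> A" "y < m \<or> M < y \<or> y \<in> A"
      using xy m M by (auto simp: A'_def order_le_less)
    show "f' x < f' y"
    proof (cases "x \<in> A \<and> y \<in> A")
      case True then show ?thesis using xy f f'f by (auto simp: strict_mono_on_def)
    next
      case False
      then show ?thesis using X xy m M fle[of m M] fle[of m y] fle[of x M] f'f
        by (fastforce simp: f'_def)
    qed
  qed
  moreover have "f' ` A' = B'"
  proof
    show "f' ` A' \<subseteq> B'" using f f'f m M by (force simp: A'_def B'_def f'_def)
    show "B' \<subseteq> f' ` A'"
    proof
      fix y assume "y \<in> B'"
      then consider "y < f m" | "y > f M" | "y \<in> B"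
        using f m M by (auto simp: B'_def order_le_less)
      then show "y \<in> f' ` A'"
      proof cases
        case 1 then show ?thesis by (intro image_eqI[of _ _ "m + (y - f m)"]) (auto simp: A'_def f'_def)
      next
        case 2 then show ?thesis using m(2)[OF M(1)]
          by (intro image_eqI[of _ _ "M + (y - f M)"]) (auto simp: A'_def f'_def)
      next
        case 3
        then obtain z where "z \<in> A" "y = f z" using f by blast
        then show ?thesis by (intro image_eqI[of _ _ z]) (auto simp: A'_def f'f)
      qed
    qed
  qed
  moreover have "closed A'" "closed B'"
    unfolding A'_def B'_def
    by (intro closed_Un closed_atMost closed_atLeast compact_imp_closed A B)+
  moreover have "\<exists>y\<in>A'. y \<le> x" "\<exists>y\<in>A'. x \<le> y" for x
    by (rule bexI[of _ "min m x"], auto simp: A'_def) (rule bexI[of _ "max M x"], auto)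
  moreover have "\<exists>y\<in>B'. y \<le> x" "\<exists>y\<in>B'. x \<le> y" for x
    by (rule bexI[of _ "min (f m) x"], auto simp: B'_def) (rule bexI[of _ "max (f M) x"], auto)
  ultimately obtain g where g: "strict_mono g" "surj g" "\<forall>x\<in>A'. g x = f' x"
    using strict_mono_extension_unbounded[of A' B' f'] by blast
  have "g ` A = B" using g(3) f f'f by (force simp: A'_def)
  then show ?thesis using g(1,2) that by blast
qed

subsection \<open>Ranked sets\<close>

text \<open>For compact \<open>K\<close> these are the relatively clopen subsets. Compactness of
  both pieces expresses this without a subspace topology and forces \<open>K\<close> to be
  compact.\<close>

definition clopen_part :: "real set \<Rightarrow> real set \<Rightarrow> bool" where
  "clopen_part D K \<longleftrightarrow> D \<subseteq> K \<and> compact D \<and> compact (K - D)"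

lemma clopen_part_refl: "compact K \<Longrightarrow> clopen_part K K"
  by (simp add: clopen_part_def)

lemma clopen_part_trans:
  assumes "clopen_part E D" "clopen_part D K" shows "clopen_part E K"
proof -
  have "K - E = (K - D) \<union> (D - E)" using assms by (auto simp: clopen_part_def)
  then show ?thesis using assms by (auto simp: clopen_part_def)
qed

lemma clopen_part_Int:
  assumes "clopen_part D K" "S \<subseteq> K" "compact S" shows "clopen_part (D \<inter> S) S"
proof -
  have "S - D \<inter> S = S \<inter> (K - D)" using assms by auto
  then show ?thesis using assms by (auto simp: clopen_part_def intro: compact_Int)
qed

lemma clopen_part_subset:
  assumes "clopen_part D K" "D \<subseteq> S" "S \<subseteq> K" "compact S" shows "clopen_part D S"
  using clopen_part_Int[OF assms(1,3,4)] assms(2) by (simp add: Int_absorb2)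

lemma clopen_part_Un:
  assumes "clopen_part D K" "compact L" "K \<inter> L = {}" shows "clopen_part D (K \<union> L)"
proof -
  have "K \<union> L - D = (K - D) \<union> L" using assms by (auto simp: clopen_part_def)
  then show ?thesis using assms by (auto simp: clopen_part_def)
qed

lemma clopen_part_atLeast:
  assumes "compact K" "p \<notin> K" shows "clopen_part (K \<inter> {p..}) K"
proof -
  have "K - K \<inter> {p..} = K \<inter> {..p}" using assms by (auto simp: order_le_less)
  then show ?thesis using assms by (simp add: clopen_part_def compact_Int_closed)
qed

lemma clopen_part_atMost:
  assumes "compact K" "p \<notin> K" shows "clopen_part (K \<inter> {..p}) K"
proof -
  have "K - K \<inter> {..p} = K \<inter> {p..}" using assms by (auto simp: order_le_less)
  then show ?thesis using assms by (simp add: clopen_part_def compact_Int_closed)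
qed

lemma clopen_part_atLeastAtMost:
  assumes "compact K" "p \<notin> K" "q \<notin> K" shows "clopen_part (K \<inter> {p..q}) K"
proof -
  have "clopen_part (K \<inter> {p..} \<inter> {..q}) (K \<inter> {p..})"
    using assms by (intro clopen_part_atMost compact_Int_closed) auto
  from clopen_part_trans[OF this clopen_part_atLeast[OF assms(1,2)]]
  show ?thesis by (simp add: Int_assoc atLeastAtMost_def)
qed

lemma connected_clopen_part:
  assumes "connected S" "S \<subseteq> K" "clopen_part D K" "x \<in> S" "x \<in> D"
  shows "S \<subseteq> D"
proof -
  have "D \<inter> (K - D) \<inter> S = {}" "S \<subseteq> D \<union> (K - D)" "closed D" "closed (K - D)" "D \<inter> S \<noteq> {}"
    using assms by (auto simp: clopen_part_def compact_imp_closed)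
  then have "(K - D) \<inter> S = {}" using connected_closedD[OF assms(1)] by metis
  with assms(2) show ?thesis by auto
qed

section \<open>The rank and its behaviour on clopen parts\<close>

text \<open>For the least \<open>\<alpha>\<close> this says \<open>K = {a..b}\<close>. In the last
  premise a small ball around an end, minus \<open>{a..b}\<close>, lies on one side of that end, so
  the pieces approach it from outside.\<close>

inductive ranked :: "'a::wellorder \<Rightarrow> real set \<Rightarrow> bool" where
  ranked: "compact K \<Longrightarrow> a < b \<Longrightarrow> {a..b} \<subseteq> K \<Longrightarrow>
    \<forall>x\<in>K - {a..b}. \<exists>\<beta> D. \<beta> < \<alpha> \<and> ranked \<beta> D \<and> x \<in> D \<and> D \<subseteq> K - {a..b} \<and> clopen_part D K \<Longrightarrow>
    \<forall>\<beta><\<alpha>. \<forall>e\<in>{a,b}. \<forall>\<epsilon>>0. \<exists>D. ranked \<beta> D \<and> D \<subseteq> ball e \<epsilon> - {a..b} \<and> clopen_part D K \<Longrightarrow>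
    ranked \<alpha> K"

text \<open>The kind of set found away from the main interval of a set of rank
  \<open>\<alpha>\<close>. Unlike \<open>ranked \<alpha>\<close>, it passes to all clopen parts,
  including the empty one, and to disjoint unions of two compact sets.\<close>

definition locally_below :: "'a::wellorder \<Rightarrow> real set \<Rightarrow> bool" where
  "locally_below \<alpha> P \<longleftrightarrow> (\<forall>x\<in>P. \<exists>\<beta> D. \<beta> < \<alpha> \<and> ranked \<beta> D \<and> x \<in> D \<and> clopen_part D P)"

lemma ranked_compact: "ranked \<alpha> K \<Longrightarrow> compact K"
  by (auto elim: ranked.cases)

text \<open>The marked point is an end of the main interval. Being connected, the main interval lies
  in a clopen part \<open>D\<close> or misses it; in the first case it serves \<open>D\<close> as
  main interval, in the second only pieces of lower rank are left. The induction is there because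
  these pieces have to be intersected with \<open>D\<close>.\<close>

lemma ranked_clopen_parts:
  assumes "ranked \<alpha> K"
  shows "\<exists>x\<in>K. \<forall>D. clopen_part D K \<longrightarrow> (if x \<in> D then ranked \<alpha> D else locally_below \<alpha> D)"
  using assms
proof induction
  case (ranked K a b \<alpha>)
  \<comment> \<open>\<open>Q \<beta> E\<close> is the induction hypothesis for a piece
    \<open>E\<close> of rank \<open>\<beta>\<close>.\<close>
  define Q where "Q \<beta> E \<longleftrightarrow>
    (\<exists>x\<in>E. \<forall>D. clopen_part D E \<longrightarrow> (if x \<in> D then ranked \<beta> D else locally_below \<beta> D))"
    for \<beta> :: 'a and E
  note IH = ranked.IH[folded Q_def]
  have sub: "ranked \<beta> D \<or> locally_below \<beta> D" if "Q \<beta> E" "clopen_part D E" for \<beta> D E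
    using that unfolding Q_def by metis
  have loc: "\<exists>\<beta> E. \<beta> < \<alpha> \<and> ranked \<beta> E \<and> x \<in> E \<and> E \<subseteq> D - {a..b} \<and> clopen_part E D"
    if D: "clopen_part D K" and x: "x \<in> D - {a..b}" for D x
  proof -
    have DK: "D \<subseteq> K" "compact D" using D by (auto simp: clopen_part_def)
    then obtain \<beta> E where E: "\<beta> < \<alpha>" "x \<in> E" "E \<subseteq> K - {a..b}" "clopen_part E K" "Q \<beta> E"
      using IH(1) x by blast
    have ED: "clopen_part (E \<inter> D) D" using clopen_part_Int[OF E(4) DK] .
    have "clopen_part (E \<inter> D) E"
      using clopen_part_Int[OF D, of E] E(4) by (auto simp: clopen_part_def Int_commute)
    \<comment> \<open>The intersection may miss the main interval of \<open>E\<close> and lose the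
      rank \<open>\<beta>\<close>; then a piece of still lower rank around \<open>x\<close> replaces
      it.\<close>
    with sub[OF E(5)] consider "ranked \<beta> (E \<inter> D)" | "locally_below \<beta> (E \<inter> D)" by blast
    then show ?thesis
    proof cases
      case 1
      then show ?thesis using E x ED by (intro exI[of _ \<beta>] exI[of _ "E \<inter> D"]) auto
    next
      case 2
      moreover have "x \<in> E \<inter> D" using x E by simp
      ultimately obtain \<gamma> F where F: "\<gamma> < \<beta>" "ranked \<gamma> F" "x \<in> F" "clopen_part F (E \<inter> D)"
        unfolding locally_below_def by blast
      then have "F \<subseteq> D - {a..b}" using E by (auto simp: clopen_part_def)
      then show ?thesis using F E clopen_part_trans[OF F(4) ED] less_trans by blast
    qed
  qed
  show ?case
  proof (intro bexI[of _ a] allI impI)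
    show "a \<in> K" using ranked by auto
    fix D assume D: "clopen_part D K"
    then have DK: "D \<subseteq> K" "compact D" "compact (K - D)" by (auto simp: clopen_part_def)
    show "if a \<in> D then ranked \<alpha> D else locally_below \<alpha> D"
    proof (cases "a \<in> D")
      case True
      have J: "{a..b} \<subseteq> D"
        by (rule connected_clopen_part[OF _ _ D, of _ a]) (use ranked.hyps True in auto)
      have "ranked \<alpha> D"
      proof (rule ranked.ranked[OF DK(2) ranked.hyps(2) J])
        show "\<forall>x\<in>D - {a..b}. \<exists>\<beta> E. \<beta> < \<alpha> \<and> ranked \<beta> E \<and> x \<in> E \<and> E \<subseteq> D - {a..b} \<and> clopen_part E D"
          using loc[OF D] by blast
        show "\<forall>\<beta><\<alpha>. \<forall>e\<in>{a,b}. \<forall>\<epsilon>>0. \<exists>E. ranked \<beta> E \<and> E \<subseteq> ball e \<epsilon> - {a..b} \<and> clopen_part E D"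
        proof (intro allI impI ballI)
          fix \<beta> e and \<epsilon> :: real assume *: "\<beta> < \<alpha>" "e \<in> {a,b}" "0 < \<epsilon>"
          have "e \<in> - (K - D)" using * J ranked.hyps(2) by auto
          \<comment> \<open>A ball that avoids \<open>K - D\<close> ensures that the piece found in
            \<open>K\<close> near \<open>e\<close> lies in \<open>D\<close>.\<close>
          then obtain \<epsilon>' where \<epsilon>': "\<epsilon>' > 0" "ball e \<epsilon>' \<subseteq> - (K - D)"
            using DK(3) by (metis compact_imp_closed open_Compl open_contains_ball)
          obtain E where E: "ranked \<beta> E" "E \<subseteq> ball e (min \<epsilon> \<epsilon>') - {a..b}" "clopen_part E K"
            using IH(2) * \<epsilon>' by (metis min_less_iff_conj)
          have "E \<subseteq> ball e \<epsilon>" "E \<subseteq> ball e \<epsilon>'" using E(2) by auto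
          moreover have "E \<subseteq> K" using E(3) by (simp add: clopen_part_def)
          ultimately have "E \<subseteq> D" using \<epsilon>'(2) by blast
          then have "clopen_part E D" using clopen_part_subset[OF E(3) _ DK(1,2)] by blast
          then show "\<exists>E. ranked \<beta> E \<and> E \<subseteq> ball e \<epsilon> - {a..b} \<and> clopen_part E D"
            using E(1,2) \<open>E \<subseteq> ball e \<epsilon>\<close> by blast
        qed
      qed
      with True show ?thesis by simp
    next
      case False
      have "D \<inter> {a..b} = {}"
      proof (rule ccontr)
        assume "D \<inter> {a..b} \<noteq> {}"
        then obtain y where "y \<in> D" "y \<in> {a..b}" by blast
        then have "{a..b} \<subseteq> D"
          using connected_clopen_part[OF _ _ D, of "{a..b}" y] ranked.hyps by auto
        moreover have "a \<in> {a..b}" using ranked.hyps(2) by simp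
        ultimately show False using False by blast
      qed
      then have "locally_below \<alpha> D" unfolding locally_below_def
        using loc[OF D] by (metis DiffI disjoint_iff)
      with False show ?thesis by simp
    qed
  qed
qed

lemma ranked_clopen_part:
  assumes "ranked \<alpha> K" "clopen_part D K" shows "ranked \<alpha> D \<or> locally_below \<alpha> D"
  using ranked_clopen_parts[OF assms(1)] assms(2) by metis

text \<open>The pieces are clopen in the ambient set \<open>P\<close> and may stick out of
  \<open>D\<close>. Cutting them down to \<open>D\<close> keeps their rank or leaves something
  locally below it, so a piece of rank less than \<open>\<alpha>\<close> remains around each
  point.\<close>

lemma locally_below_clopen_partI:
  assumes P: "\<And>x. x \<in> D \<Longrightarrow> \<exists>\<beta> E. \<beta> < \<alpha> \<and> ranked \<beta> E \<and> x \<in> E \<and> clopen_part E P"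
    and D: "clopen_part D P"
  shows "locally_below \<alpha> D"
  unfolding locally_below_def
proof
  fix x assume x: "x \<in> D"
  have DP: "D \<subseteq> P" "compact D" using D by (auto simp: clopen_part_def)
  then obtain \<beta> E where E: "\<beta> < \<alpha>" "ranked \<beta> E" "x \<in> E" "clopen_part E P"
    using P[OF x] by blast
  have ED: "clopen_part (E \<inter> D) D" using clopen_part_Int[OF E(4) DP] .
  have "clopen_part (E \<inter> D) E"
    using clopen_part_Int[OF D, of E] E(4) by (auto simp: clopen_part_def Int_commute)
  with ranked_clopen_part[OF E(2)] consider "ranked \<beta> (E \<inter> D)" | "locally_below \<beta> (E \<inter> D)" by blast
  then show "\<exists>\<beta> E. \<beta> < \<alpha> \<and> ranked \<beta> E \<and> x \<in> E \<and> clopen_part E D"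
  proof cases
    case 1
    then show ?thesis using E x ED by blast
  next
    case 2
    moreover have "x \<in> E \<inter> D" using x E by simp
    ultimately obtain \<gamma> F where F: "\<gamma> < \<beta>" "ranked \<gamma> F" "x \<in> F" "clopen_part F (E \<inter> D)"
      unfolding locally_below_def by blast
    then show ?thesis using E clopen_part_trans[OF F(4) ED] less_trans by blast
  qed
qed

lemma locally_below_clopen_part:
  assumes "locally_below \<alpha> P" and D: "clopen_part D P" shows "locally_below \<alpha> D"
  by (rule locally_below_clopen_partI[OF _ D])
    (use assms in \<open>auto simp: locally_below_def clopen_part_def\<close>)

lemma locally_below_mono: "locally_below \<alpha> P \<Longrightarrow> \<alpha> \<le> \<beta> \<Longrightarrow> locally_below \<beta> P"
  unfolding locally_below_def by (meson less_le_trans)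

lemma ranked_imp_locally_below: "ranked \<beta> P \<Longrightarrow> \<beta> < \<alpha> \<Longrightarrow> locally_below \<alpha> P"
  unfolding locally_below_def using clopen_part_refl ranked_compact by blast

lemma locally_below_Un:
  assumes "locally_below \<alpha> P" "locally_below \<alpha> Q" "compact P" "compact Q" "P \<inter> Q = {}"
  shows "locally_below \<alpha> (P \<union> Q)"
proof -
  have "clopen_part D (P \<union> Q)" if "clopen_part D P" for D
    using clopen_part_Un that assms by blast
  moreover have "clopen_part D (P \<union> Q)" if "clopen_part D Q" for D
    using clopen_part_Un[of D Q P] that assms by (simp add: Un_commute Int_commute)
  ultimately show ?thesis using assms(1,2) unfolding locally_below_def by blast
qed

text \<open>Absorption: the main interval of \<open>K\<close> also serves for the union, because
  clopen parts of either set stay clopen in it and \<open>P\<close> only contributes pieces of lower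
  rank.\<close>

lemma ranked_Un:
  assumes K: "ranked \<alpha> K" and P: "locally_below \<alpha> P" "compact P" "P \<inter> K = {}"
  shows "ranked \<alpha> (P \<union> K)"
  using K
proof cases
  case (ranked a b)
  have cl: "clopen_part D (P \<union> K)" if "clopen_part D P" for D
    using clopen_part_Un that P ranked_compact[OF K] by blast
  have cl': "clopen_part D (P \<union> K)" if "clopen_part D K" for D
    using clopen_part_Un[of D K P] that P by (simp add: Un_commute Int_commute)
  show ?thesis
  proof (rule ranked.ranked)
    show "compact (P \<union> K)" using P ranked by auto
    show "a < b" "{a..b} \<subseteq> P \<union> K" using ranked by auto
    show "\<forall>x\<in>P \<union> K - {a..b}. \<exists>\<beta> D. \<beta> < \<alpha> \<and> ranked \<beta> D \<and> x \<in> D \<and> D \<subseteq> P \<union> K - {a..b} \<and> clopen_part D (P \<union> K)"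
    proof
      fix x assume x: "x \<in> P \<union> K - {a..b}"
      show "\<exists>\<beta> D. \<beta> < \<alpha> \<and> ranked \<beta> D \<and> x \<in> D \<and> D \<subseteq> P \<union> K - {a..b} \<and> clopen_part D (P \<union> K)"
      proof (cases "x \<in> P")
        case True
        then obtain \<beta> D where D: "\<beta> < \<alpha>" "ranked \<beta> D" "x \<in> D" "clopen_part D P"
          using P(1) by (auto simp: locally_below_def)
        then have "D \<subseteq> P \<union> K - {a..b}" using P(3) ranked by (auto simp: clopen_part_def)
        then show ?thesis using D cl by blast
      next
        case False
        then obtain \<beta> D where "\<beta> < \<alpha>" "ranked \<beta> D" "x \<in> D" "D \<subseteq> K - {a..b}" "clopen_part D K"
          using ranked x by blast
        then show ?thesis using cl' by blast
      qed
    qed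
    show "\<forall>\<beta><\<alpha>. \<forall>e\<in>{a,b}. \<forall>\<epsilon>>0. \<exists>D. ranked \<beta> D \<and> D \<subseteq> ball e \<epsilon> - {a..b} \<and> clopen_part D (P \<union> K)"
      using ranked(5) cl' by meson
  qed
qed

text \<open>If \<open>K\<close> had ranks \<open>\<gamma> < \<beta>\<close>, then rank
  \<open>\<beta>\<close> would give two disjoint clopen parts of rank \<open>\<gamma>\<close> near
  an end of the main interval. One of them misses the marked point that \<open>K\<close> has as a
  set of rank \<open>\<gamma>\<close>, so it is locally below \<open>\<gamma>\<close>, which a set
  of rank \<open>\<gamma>\<close> never is.\<close>

lemma ranked_unique: "ranked \<beta> K \<Longrightarrow> ranked \<gamma> K \<Longrightarrow> \<beta> = \<gamma>"
proof -
  have *: "\<not> \<gamma> < \<beta>" if "ranked \<beta> K" "ranked \<gamma> K" for \<beta> \<gamma> :: "'a::wellorder" and K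
    using that
  proof (induction \<gamma> arbitrary: \<beta> K rule: less_induct)
    case (less \<gamma>)
    \<comment> \<open>A clopen part around the marked point \<open>y\<close> keeps the rank
      \<open>\<gamma>\<close>; by the induction hypothesis it cannot also have a rank below
      \<open>\<gamma>\<close>.\<close>
    have nloc: "\<not> locally_below \<gamma> D" if D: "ranked \<gamma> D" for D
    proof
      assume loc: "locally_below \<gamma> D"
      obtain y where y: "y \<in> D" "\<forall>E. clopen_part E D \<longrightarrow> y \<in> E \<longrightarrow> ranked \<gamma> E"
        using ranked_clopen_parts[OF D] by metis
      then obtain \<delta> E where "\<delta> < \<gamma>" "ranked \<delta> E" "y \<in> E" "clopen_part E D"
        using loc unfolding locally_below_def by blast
      then show False using y(2) less.IH[of \<delta> \<gamma> E] by blast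
    qed
    show ?case
    proof
      assume lt: "\<gamma> < \<beta>"
      from less.prems(1) show False
      proof cases
        case (ranked a b)
        obtain D1 where D1: "ranked \<gamma> D1" "D1 \<subseteq> ball a 1 - {a..b}" "clopen_part D1 K"
          using ranked(5) lt by (metis insertI1 zero_less_one)
        have "a \<in> - D1" using D1(2) ranked by auto
        then obtain \<epsilon> where \<epsilon>: "\<epsilon> > 0" "ball a \<epsilon> \<subseteq> - D1"
          using ranked_compact[OF D1(1)] by (metis compact_imp_closed open_Compl open_contains_ball)
        obtain D2 where D2: "ranked \<gamma> D2" "D2 \<subseteq> ball a \<epsilon> - {a..b}" "clopen_part D2 K"
          using ranked(5) lt \<epsilon> by (metis insertI1)
        obtain x where x: "x \<in> K" "\<forall>D. clopen_part D K \<longrightarrow> x \<notin> D \<longrightarrow> locally_below \<gamma> D"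
          using ranked_clopen_parts[OF less.prems(2)] by metis
        have "D1 \<inter> D2 = {}" using D2 \<epsilon> by blast
        then have "x \<notin> D1 \<or> x \<notin> D2" by blast
        then show False
          using x(2) nloc[OF D1(1)] nloc[OF D2(1)] D1(3) D2(3) by blast
      qed
    qed
  qed
  assume "ranked \<beta> K" "ranked \<gamma> K"
  then show "\<beta> = \<gamma>" using *[of \<beta> K \<gamma>] *[of \<gamma> K \<beta>] by (cases \<beta> \<gamma> rule: linorder_cases) auto
qed

lemma ranked_not_locally_below:
  assumes "ranked \<alpha> D" shows "\<not> locally_below \<alpha> D"
proof
  assume loc: "locally_below \<alpha> D"
  obtain y where y: "y \<in> D" "\<forall>E. clopen_part E D \<longrightarrow> y \<in> E \<longrightarrow> ranked \<alpha> E"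
    using ranked_clopen_parts[OF assms] by metis
  then obtain \<delta> E where "\<delta> < \<alpha>" "ranked \<delta> E" "y \<in> E" "clopen_part E D"
    using loc unfolding locally_below_def by blast
  then show False using y ranked_unique[of \<delta> E \<alpha>] by auto
qed

section \<open>Invariance of the rank under homeomorphisms\<close>

text \<open>A continuous injection takes at an interior point a value strictly between those at the
  ends, so the extremes occur at the ends. Equating unordered pairs leaves open whether the
  orientation is reversed.\<close>

lemma injective_image_interval:
  fixes f :: "real \<Rightarrow> real"
  assumes ab: "a < b" and cont: "continuous_on {a..b} f" and inj: "inj_on f {a..b}"
  obtains c d where "c < d" "f ` {a..b} = {c..d}" "{c, d} = f ` {a, b}"
proof -
  obtain c d where cd: "f ` {a..b} = {c..d}" "c \<le> d"
    using continuous_image_closed_interval[of a b f] ab cont by auto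
  have "f a \<noteq> f b" using inj_onD[OF inj, of a b] ab by auto
  moreover have "f a \<in> {c..d}" "f b \<in> {c..d}" using cd ab by (auto simp flip: cd(1))
  ultimately have "c < d" by auto
  have bd: "f x \<in> f ` {a, b}" if "x \<in> {a..b}" "f x = c \<or> f x = d" for x
  proof (rule ccontr)
    assume "f x \<notin> f ` {a, b}"
    then have "a < x" "x < b" using that by (auto simp: order_le_less)
    from continuous_inj_imp_mono[OF this cont inj] show False
      using that \<open>f a \<in> {c..d}\<close> \<open>f b \<in> {c..d}\<close> by auto
  qed
  have "c \<in> f ` {a..b}" "d \<in> f ` {a..b}" using cd by auto
  then have "c \<in> f ` {a, b}" "d \<in> f ` {a, b}" using bd by blast+
  then have "{c, d} = f ` {a, b}" using \<open>c < d\<close> by auto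
  then show ?thesis using that cd \<open>c < d\<close> by blast
qed

text \<open>A homeomorphism may flip the main interval or some of the pieces. This does no harm,
  since the definition asks the same of both ends and is otherwise topological.\<close>

lemma ranked_homeomorphism:
  assumes "ranked \<alpha> K" "homeomorphism K K' f g" shows "ranked \<alpha> K'"
  using assms
proof (induction arbitrary: K' f g)
  case (ranked K a b \<alpha>)
  note hom = ranked.prems
  define Q where "Q \<beta> D \<longleftrightarrow> (\<forall>K' f g. homeomorphism D K' f g \<longrightarrow> ranked \<beta> K')"
    for \<beta> :: 'a and D :: "real set"
  note IH = ranked.IH[folded Q_def]
  have QD: "ranked \<beta> K'" if "Q \<beta> D" "homeomorphism D K' f g" for \<beta> D K' f g
    using that unfolding Q_def by metis
  have cont: "continuous_on K f" and K': "K' = f ` K" and gf: "\<And>x. x \<in> K \<Longrightarrow> g (f x) = x"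
    using hom by (auto simp: homeomorphism_def)
  have inj: "inj_on f K" using gf by (rule inj_on_inverseI)
  obtain c d where cd: "c < d" "f ` {a..b} = {c..d}" "{c, d} = f ` {a, b}"
    using injective_image_interval[of a b f] ranked.hyps cont inj
    by (metis continuous_on_subset inj_on_subset)
  have cl: "clopen_part (f ` D) K'" if "clopen_part D K" for D
  proof -
    have "D \<subseteq> K" "K' - f ` D = f ` (K - D)"
      using that inj by (auto simp: K' clopen_part_def inj_on_image_set_diff[OF inj])
    then show ?thesis using that cont
      by (auto simp: clopen_part_def K' intro!: compact_continuous_image intro: continuous_on_subset)
  qed
  have homD: "homeomorphism D (f ` D) f g" if "clopen_part D K" for D
    using that hom by (auto simp: clopen_part_def K' intro: homeomorphism_of_subsets)
  have disj: "f ` D \<subseteq> K' - {c..d}" if "D \<subseteq> K - {a..b}" for D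
    using that ranked.hyps(3) inj unfolding K' cd(2)[symmetric] by (auto dest: inj_onD)
  show ?case
  proof (rule ranked.ranked[OF _ cd(1)])
    show "compact K'" using cont ranked.hyps(1) by (simp add: K' compact_continuous_image)
    show "{c..d} \<subseteq> K'" using ranked.hyps(3) by (auto simp: K' simp flip: cd(2))
    show "\<forall>x\<in>K' - {c..d}. \<exists>\<beta> D. \<beta> < \<alpha> \<and> ranked \<beta> D \<and> x \<in> D \<and> D \<subseteq> K' - {c..d} \<and> clopen_part D K'"
    proof
      fix y assume "y \<in> K' - {c..d}"
      then have "y \<in> f ` K" "y \<notin> f ` {a..b}" by (simp_all add: K' cd(2))
      then obtain x where x: "y = f x" "x \<in> K - {a..b}" by blast
      then obtain \<beta> D where D: "\<beta> < \<alpha>" "x \<in> D" "D \<subseteq> K - {a..b}" "clopen_part D K" "Q \<beta> D"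
        using IH(1) by blast
      then show "\<exists>\<beta> D. \<beta> < \<alpha> \<and> ranked \<beta> D \<and> y \<in> D \<and> D \<subseteq> K' - {c..d} \<and> clopen_part D K'"
        using D(1,2) x disj[OF D(3)] cl[OF D(4)] QD[OF D(5) homD[OF D(4)]] by (intro exI[of _ \<beta>] exI[of _ "f ` D"]) blast
    qed
    show "\<forall>\<beta><\<alpha>. \<forall>e\<in>{c,d}. \<forall>\<epsilon>>0. \<exists>D. ranked \<beta> D \<and> D \<subseteq> ball e \<epsilon> - {c..d} \<and> clopen_part D K'"
    proof (intro allI impI ballI)
      fix \<beta> e' and \<epsilon> :: real assume *: "\<beta> < \<alpha>" "e' \<in> {c,d}" "0 < \<epsilon>"
      then obtain e where e: "e \<in> {a,b}" "e' = f e" using cd(3) by auto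
      then have "e \<in> K" using ranked.hyps by auto
      then obtain \<delta> where \<delta>: "\<delta> > 0" "\<And>x. x \<in> K \<Longrightarrow> dist x e < \<delta> \<Longrightarrow> dist (f x) (f e) < \<epsilon>"
        using cont *(3) unfolding continuous_on_iff by metis
      obtain D where D: "D \<subseteq> ball e \<delta> - {a..b}" "clopen_part D K" "Q \<beta> D"
        using IH(2) *(1) e(1) \<delta>(1) by blast
      have "D \<subseteq> K" using D(2) by (simp add: clopen_part_def)
      have "dist e' (f x) < \<epsilon>" if "x \<in> D" for x
      proof -
        have "x \<in> ball e \<delta>" "x \<in> K" using D(1) \<open>D \<subseteq> K\<close> that by blast+
        then show ?thesis using \<delta>(2)[of x] by (simp add: e(2) dist_commute)
      qed
      then have "f ` D \<subseteq> ball e' \<epsilon>" by auto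
      moreover have "f ` D \<subseteq> K' - {c..d}" using D(1) \<open>D \<subseteq> K\<close> by (intro disj) auto
      ultimately show "\<exists>D. ranked \<beta> D \<and> D \<subseteq> ball e' \<epsilon> - {c..d} \<and> clopen_part D K'"
        using QD[OF D(3) homD[OF D(2)]] cl[OF D(2)] by (intro exI[of _ "f ` D"]) blast
    qed
  qed
qed

lemma ranked_strict_mono_image:
  assumes "ranked \<alpha> K" "strict_mono F" "surj F" shows "ranked \<alpha> (F ` K)"
  using strict_mono_surj_homeomorphism[OF assms(2,3)]
  by (rule ranked_homeomorphism[OF assms(1) homeomorphism_of_subsets]) auto

lemma ranked_affine:
  assumes "ranked \<alpha> K" "m \<noteq> 0" shows "ranked \<alpha> ((\<lambda>x. m * x + c) ` K)"
proof (rule ranked_homeomorphism[OF assms(1)])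
  show "homeomorphism K ((\<lambda>x. m * x + c) ` K) (\<lambda>x. m * x + c) (\<lambda>y. (y - c) / m)"
    using assms(2) by (auto simp: homeomorphism_def image_image intro!: continuous_intros)
qed

lemma ranked_uminus:
  assumes "ranked \<alpha> K" shows "ranked \<alpha> (uminus ` K)"
  using ranked_affine[OF assms, of "- 1" 0] by simp

section \<open>Decomposition into blocks from right to left\<close>

lemma precedes_cut:
  assumes "compact X" "compact Y" "X \<lless> Y"
  obtains p where "\<forall>x\<in>X. x < p" "\<forall>y\<in>Y. p < y"
proof -
  consider "X = {}" | "Y = {}" | "X \<noteq> {}" "Y \<noteq> {}" by blast
  then show thesis
  proof cases
    case 1
    obtain m where "\<And>y. y \<in> Y \<Longrightarrow> m \<le> y"
      using compact_imp_bounded[OF assms(2)] bounded_imp_bdd_below unfolding bdd_below_def by blast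
    then show ?thesis using that[of "m - 1"] 1 by force
  next
    case 2
    obtain m where "\<And>x. x \<in> X \<Longrightarrow> x \<le> m"
      using compact_imp_bounded[OF assms(1)] bounded_imp_bdd_above unfolding bdd_above_def by blast
    then show ?thesis using that[of "m + 1"] 2 by force
  next
    case 3
    obtain M where M: "M \<in> X" "\<And>x. x \<in> X \<Longrightarrow> x \<le> M" using compact_attains_sup assms 3 by metis
    obtain m where m: "m \<in> Y" "\<And>y. y \<in> Y \<Longrightarrow> m \<le> y" using compact_attains_inf assms 3 by metis
    have "M < m" using assms(3) M m by (simp add: precedes_def)
    then show ?thesis using that[of "(M + m) / 2"] M m by force
  qed
qed

text \<open>Let \<open>\<beta>\<close> be the least rank of a clopen part around \<open>x\<close>. A
  smaller clopen part around \<open>x\<close> again has rank \<open>\<beta>\<close>, since otherwise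
  it would contain one of lower rank. Hence one left cut \<open>p\<close> works for all right cuts
  \<open>t\<close> close to \<open>x\<close>, which is what the induction below uses at an infimum
  of cuts.\<close>

lemma locally_below_ranked_interval:
  assumes P: "locally_below \<alpha> P" "compact P" and x: "x \<in> P"
  obtains \<beta> p q where "\<beta> < \<alpha>" "p < x" "x < q" "p \<notin> P"
    "\<forall>t. x < t \<and> t < q \<and> t \<notin> P \<longrightarrow> ranked \<beta> (P \<inter> {p..t})"
proof -
  define R where "R \<beta> \<longleftrightarrow> (\<exists>D. ranked \<beta> D \<and> x \<in> D \<and> clopen_part D P)" for \<beta> :: 'a
  obtain \<beta>0 where \<beta>0: "\<beta>0 < \<alpha>" "R \<beta>0" using P(1) x unfolding locally_below_def R_def by blast
  define \<beta> where "\<beta> = (LEAST \<beta>. R \<beta>)"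
  have "R \<beta>" "\<beta> \<le> \<beta>0" unfolding \<beta>_def using \<beta>0(2) by (auto intro: LeastI Least_le)
  then obtain D where D: "ranked \<beta> D" "x \<in> D" "clopen_part D P" by (auto simp: R_def)
  have DP: "D \<subseteq> P" "compact D" "compact (P - D)" using D by (auto simp: clopen_part_def)
  have "x \<in> - (P - D)" using D by simp
  then obtain \<epsilon> where \<epsilon>: "\<epsilon> > 0" "ball x \<epsilon> \<subseteq> - (P - D)"
    using DP(3) by (metis compact_imp_closed open_Compl open_contains_ball)
  let ?X = "(P - D) \<inter> {..x}"
  \<comment> \<open>\<open>m\<close> is the last point of \<open>P - D\<close> left of
    \<open>x\<close>, or a point below all of \<open>D\<close> if there is none; strictly right of
    \<open>m\<close> and up to \<open>x\<close>, the sets \<open>P\<close> and \<open>D\<close>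
    agree.\<close>
  obtain m where m: "\<And>z. z \<in> ?X \<Longrightarrow> z \<le> m" "m < x" "m \<notin> D"
  proof (cases "?X = {}")
    case True
    obtain l where l: "\<And>z. z \<in> D \<Longrightarrow> l \<le> z"
      using compact_imp_bounded[OF DP(2)] bounded_imp_bdd_below unfolding bdd_below_def by blast
    then have "l - 1 \<notin> D" "l - 1 < x" using D(2) by force+
    then show ?thesis using that[of "l - 1"] True by blast
  next
    case False
    have "compact ?X" using DP by (simp add: compact_Int_closed)
    then obtain m where "m \<in> ?X" "\<And>z. z \<in> ?X \<Longrightarrow> z \<le> m"
      using False by (metis compact_attains_sup)
    then show ?thesis using that[of m] D(2) by force
  qed
  let ?Y = "D \<inter> {m..x}"
  have "{m} \<lless> ?Y"
    using m D by (auto simp: precedes_def order_le_less)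
  moreover have "compact ?Y" using DP(2) by (simp add: compact_Int_closed)
  ultimately obtain p where p: "m < p" "\<forall>y\<in>?Y. p < y"
    using precedes_cut[of "{m}" ?Y] by (metis compact_sing insertI1)
  have px: "p < x" using p D m by auto
  have pP: "p \<notin> P" using p m(1)[of p] px by force
  have "ranked \<beta> (P \<inter> {p..t})" if t: "x < t" "t < x + \<epsilon>" "t \<notin> P" for t
  proof -
    have "P \<inter> {p..t} \<subseteq> D"
    proof
      fix z assume z: "z \<in> P \<inter> {p..t}"
      show "z \<in> D"
      proof (rule ccontr)
        assume "z \<notin> D"
        with z have "z \<in> P - D" by blast
        moreover from this have "z \<notin> ball x \<epsilon>" using \<epsilon> by blast
        ultimately show False using m(1)[of z] z p t
          by (auto simp: dist_real_def abs_if split: if_splits)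
      qed
    qed
    moreover have cl: "clopen_part (P \<inter> {p..t}) P" using clopen_part_atLeastAtMost P pP t by blast
    ultimately have "clopen_part (P \<inter> {p..t}) D" using clopen_part_subset DP by blast
    from ranked_clopen_part[OF D(1) this] show ?thesis
    proof
      assume "locally_below \<beta> (P \<inter> {p..t})"
      moreover have "x \<in> P \<inter> {p..t}" using x px t by auto
      ultimately obtain \<gamma> where "\<gamma> < \<beta>" "R \<gamma>"
        unfolding locally_below_def R_def using clopen_part_trans[OF _ cl] by blast
      then show ?thesis using not_less_Least[of \<gamma> R] by (simp add: \<beta>_def)
    qed
  qed
  then show ?thesis using that[of \<beta> p "x + \<epsilon>"] px pP \<epsilon> \<open>\<beta> \<le> \<beta>0\<close> \<beta>0 by auto
qed

text \<open>Induction along the line: a compact set that is locally below \<open>\<alpha>\<close> is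
  exhausted by blocks of rank less than \<open>\<alpha>\<close>, each put to the left of what is
  already there. The proof moves a cut leftwards and examines the infimum of the cuts that can be
  reached.\<close>

lemma locally_below_induct [consumes 2, case_names empty step]:
  assumes P: "compact P" "locally_below \<alpha> P" and "Q {}"
    and step: "\<And>A B \<beta>. \<beta> < \<alpha> \<Longrightarrow> ranked \<beta> A \<Longrightarrow> compact B \<Longrightarrow> A \<lless> B \<Longrightarrow> Q B \<Longrightarrow> Q (A \<union> B)"
  shows "Q P"
proof -
  define S where "S = {t. t \<notin> P \<and> Q (P \<inter> {t..})}"
  obtain M where M: "\<And>x. x \<in> P \<Longrightarrow> x \<le> M"
    using compact_imp_bounded[OF P(1)] bounded_imp_bdd_above unfolding bdd_above_def by blast
  have "P \<inter> {M + 1..} = {}" "M + 1 \<notin> P" using M by force+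
  then have ne: "S \<noteq> {}" using \<open>Q {}\<close> by (auto simp: S_def)
  obtain l where l: "\<And>x. x \<in> P \<Longrightarrow> l \<le> x"
    using compact_imp_bounded[OF P(1)] bounded_imp_bdd_below unfolding bdd_below_def by blast
  have "\<exists>t\<in>S. t < l"
  proof (rule ccontr)
    assume "\<not> (\<exists>t\<in>S. t < l)"
    then have bd: "bdd_below S" by (intro bdd_belowI[of _ l]) auto
    define s where "s = Inf S"
    have s: "s \<le> t" if "t \<in> S" for t unfolding s_def using bd that by (rule cInf_lower[rotated])
    have near: "\<exists>t\<in>S. t < q" if "s < q" for q
      using that cInf_less_iff[OF ne bd] unfolding s_def by blast
    show False
    proof (cases "s \<in> P")
      \<comment> \<open>No point of \<open>P\<close> is near \<open>s\<close>, so a cut at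
        \<open>s\<close> or just right of it can be moved to the left of \<open>s\<close>.\<close>
      case False
      then obtain \<epsilon> where \<epsilon>: "\<epsilon> > 0" "ball s \<epsilon> \<subseteq> - P"
        using P(1) by (metis ComplI compact_imp_closed open_Compl open_contains_ball)
      obtain t where t: "t \<in> S" "t < s + \<epsilon>" using near[of "s + \<epsilon>"] \<epsilon> by auto
      let ?u = "s - \<epsilon> / 2"
      have out: "z \<notin> P" if "?u \<le> z" "z \<le> t" for z
      proof -
        have "z \<in> ball s \<epsilon>" using that t \<epsilon>(1) by (auto simp: dist_real_def abs_if)
        then show ?thesis using \<epsilon> by blast
      qed
      have "P \<inter> {?u..} = P \<inter> {t..}" using out s[OF t(1)] \<epsilon>(1) by fastforce
      moreover have "?u \<notin> P" using out s[OF t(1)] \<epsilon>(1) by simp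
      ultimately have "?u \<in> S" using t by (simp add: S_def)
      then show False using s[of ?u] \<epsilon> by auto
    next
      \<comment> \<open>The points of \<open>P\<close> between \<open>p\<close> and a cut
        \<open>t\<close> just right of \<open>s\<close> form one more block, so that
        \<open>p < s\<close> becomes a member of \<open>S\<close>.\<close>
      case True
      obtain \<beta> p q where pq: "\<beta> < \<alpha>" "p < s" "s < q" "p \<notin> P"
        "\<forall>t. s < t \<and> t < q \<and> t \<notin> P \<longrightarrow> ranked \<beta> (P \<inter> {p..t})"
        using locally_below_ranked_interval[OF P(2,1) True] .
      obtain t where t: "t \<in> S" "t < q" using near pq by blast
      then have tP: "t \<notin> P" "Q (P \<inter> {t..})" by (auto simp: S_def)
      have "s < t" using s[OF t(1)] tP True by (metis order_le_less)
      have "Q (P \<inter> {p..t} \<union> P \<inter> {t..})"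
      proof (rule step[OF pq(1) _ _ _ tP(2)])
        show "ranked \<beta> (P \<inter> {p..t})" using pq(5) \<open>s < t\<close> t(2) tP(1) by blast
        show "compact (P \<inter> {t..})" using P by (simp add: compact_Int_closed)
        show "P \<inter> {p..t} \<lless> P \<inter> {t..}" using tP by (auto simp: precedes_def order_le_less)
      qed
      moreover have "P \<inter> {p..t} \<union> P \<inter> {t..} = P \<inter> {p..}" using pq \<open>s < t\<close> by auto
      ultimately have "p \<in> S" using pq by (simp add: S_def)
      then show False using s[of p] pq by auto
    qed
  qed
  then obtain t where "t \<in> S" "t < l" by blast
  moreover from this have "P \<inter> {t..} = P" using l by force
  ultimately show ?thesis by (simp add: S_def)
qed

subsection \<open>One-sided tails\<close>

text \<open>The claim that is proved by induction on the rank; the lemmas on tails assume it for all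
  smaller ranks.\<close>

definition order_unique :: "'a::wellorder \<Rightarrow> bool" where
  "order_unique \<alpha> \<longleftrightarrow> (\<forall>K K'. ranked \<alpha> K \<longrightarrow> ranked \<alpha> K' \<longrightarrow> K \<cong>\<^sub>o K')"

text \<open>Models the part of a set of rank \<open>\<alpha>\<close> to the right of its main
  interval; the left part is treated by reflection. The limit point \<open>b\<close> is left out, so
  compactness is only asked of the sections beyond a cut.\<close>

definition tail :: "'a::wellorder \<Rightarrow> real \<Rightarrow> real set \<Rightarrow> bool" where
  "tail \<alpha> b H \<longleftrightarrow> (\<forall>x\<in>H. b < x) \<and> (\<forall>d>b. \<exists>c. b < c \<and> c < d \<and> c \<notin> H) \<and>
    (\<forall>c>b. c \<notin> H \<longrightarrow> compact (H \<inter> {c..}) \<and> locally_below \<alpha> (H \<inter> {c..})) \<and>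
    (\<forall>\<beta><\<alpha>. \<forall>d>b. \<exists>c D. b < c \<and> c \<notin> H \<and> ranked \<beta> D \<and> clopen_part D (H \<inter> {c..}) \<and> D \<subseteq> {..<d})"

lemma tailD:
  assumes "tail \<alpha> b H"
  shows "x \<in> H \<Longrightarrow> b < x" "b < d \<Longrightarrow> \<exists>c. b < c \<and> c < d \<and> c \<notin> H"
    "b < c \<Longrightarrow> c \<notin> H \<Longrightarrow> compact (H \<inter> {c..})"
    "b < c \<Longrightarrow> c \<notin> H \<Longrightarrow> locally_below \<alpha> (H \<inter> {c..})"
    "\<beta> < \<alpha> \<Longrightarrow> b < d \<Longrightarrow>
      \<exists>c D. b < c \<and> c \<notin> H \<and> ranked \<beta> D \<and> clopen_part D (H \<inter> {c..}) \<and> D \<subseteq> {..<d}"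
  using assms unfolding tail_def by simp_all

lemma tail_bound:
  assumes "tail \<alpha> b H" obtains d where "b < d" "\<forall>x\<in>H. x < d"
proof -
  obtain c where c: "b < c" "c \<notin> H" using tailD(2)[OF assms, of "b + 1"] by auto
  obtain M where M: "\<And>x. x \<in> H \<inter> {c..} \<Longrightarrow> x \<le> M"
    using compact_imp_bounded[OF tailD(3)[OF assms c]] bounded_imp_bdd_above
    unfolding bdd_above_def by blast
  show ?thesis
  proof (rule that[of "max c M + 1"])
    show "b < max c M + 1" using c by auto
    have "x < max c M + 1" if "x \<in> H" for x using M[of x] that by (cases "c \<le> x") auto
    then show "\<forall>x\<in>H. x < max c M + 1" ..
  qed
qed

text \<open>Once an outer section has been matched, the rest is a tail at the same point and the
  matching can go on: only what happens near \<open>b\<close> matters, and sections beyond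
  \<open>e\<close> become empty.\<close>

lemma tail_restrict:
  assumes t: "tail \<alpha> b H" and e: "b < e" "e \<notin> H"
  shows "tail \<alpha> b (H \<inter> {..e})"
proof -
  have clop: "clopen_part (H \<inter> {..e} \<inter> {c..}) (H \<inter> {c..})" if "b < c" "c \<notin> H" for c
    using clopen_part_atMost[OF tailD(3)[OF t that], of e] e by (simp add: Int_ac)
  have gap: "c \<notin> H \<or> e < c" if "c \<notin> H \<inter> {..e}" for c using that by auto
  have triv: "H \<inter> {..e} \<inter> {c..} = {}" if "e < c" for c using that by auto
  show ?thesis unfolding tail_def
  proof (intro conjI allI impI ballI)
    show "b < x" if "x \<in> H \<inter> {..e}" for x using that tailD(1)[OF t] by blast
    show "\<exists>c>b. c < d \<and> c \<notin> H \<inter> {..e}" if "b < d" for d using that tailD(2)[OF t] by blast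
    fix c assume c: "b < c" "c \<notin> H \<inter> {..e}"
    show "compact (H \<inter> {..e} \<inter> {c..})"
      using gap[OF c(2)] clop[OF c(1)] triv[of c] by (auto simp: clopen_part_def)
    show "locally_below \<alpha> (H \<inter> {..e} \<inter> {c..})"
      using gap[OF c(2)]
    proof
      assume "c \<notin> H"
      then show ?thesis using locally_below_clopen_part[OF tailD(4)[OF t] clop] c by blast
    qed (simp add: triv locally_below_def)
  next
    fix \<beta> d assume \<beta>: "\<beta> < \<alpha>" and d: "b < d"
    obtain c D where D: "b < c" "c \<notin> H" "ranked \<beta> D" "clopen_part D (H \<inter> {c..})" "D \<subseteq> {..<min d e}"
      using tailD(5)[OF t \<beta>, of "min d e"] d e by auto
    have "D \<subseteq> H \<inter> {..e} \<inter> {c..}" using D(4,5) by (auto simp: clopen_part_def)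
    then have "clopen_part D (H \<inter> {..e} \<inter> {c..})"
      by (rule clopen_part_subset[OF D(4)]) (use clop[OF D(1,2)] in \<open>auto simp: clopen_part_def\<close>)
    then show "\<exists>c D. b < c \<and> c \<notin> H \<inter> {..e} \<and> ranked \<beta> D \<and> clopen_part D (H \<inter> {..e} \<inter> {c..}) \<and> D \<subseteq> {..<d}"
      using D by (intro exI[of _ c] exI[of _ D]) auto
  qed
qed

text \<open>A translated set of rank \<open>\<beta>\<close> placed to the right of \<open>K\<close>
  is absorbed, so the union has rank \<open>\<gamma>\<close> and the order type of \<open>K\<close>.
  The increasing map onto \<open>K\<close> carries the visible splitting of the union into
  \<open>K\<close>.\<close>

lemma ranked_absorb_split:
  assumes K: "ranked \<gamma> K" and u: "order_unique \<gamma>" and \<beta>: "\<beta> < \<gamma>"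
  obtains X Y where "K = X \<union> Y" "X \<lless> Y" "compact X" "ranked \<beta> Y"
proof -
  obtain E where E: "ranked \<beta> E"
    using K \<beta> by (cases) (metis insertI1 zero_less_one)
  obtain M where M: "\<And>x. x \<in> K \<Longrightarrow> x \<le> M"
    using compact_imp_bounded[OF ranked_compact[OF K]] bounded_imp_bdd_above unfolding bdd_above_def by blast
  obtain m where m: "\<And>x. x \<in> E \<Longrightarrow> m \<le> x"
    using compact_imp_bounded[OF ranked_compact[OF E]] bounded_imp_bdd_below unfolding bdd_below_def by blast
  define E' where "E' = (\<lambda>x. 1 * x + (M + 1 - m)) ` E"
  have E': "ranked \<beta> E'" unfolding E'_def by (rule ranked_affine[OF E]) simp
  have KE: "K \<lless> E'" using M m unfolding precedes_def E'_def by force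
  then have "K \<inter> E' = {}" unfolding precedes_def by fast
  then have W: "ranked \<gamma> (E' \<union> K)"
    using ranked_Un[OF K ranked_imp_locally_below[OF E' \<beta>] ranked_compact[OF E']] by auto
  then have "E' \<union> K \<cong>\<^sub>o K" using u K by (simp add: order_unique_def)
  then obtain F where F: "strict_mono F" "surj F" "F ` (E' \<union> K) = K"
    using order_iso_sets_extension ranked_compact W K by metis
  show ?thesis
  proof (rule that[of "F ` K" "F ` E'"])
    show "K = F ` K \<union> F ` E'" using F(3) by (auto simp: image_Un)
    show "F ` K \<lless> F ` E'" using KE F(1) by (auto simp: precedes_def strict_mono_def)
    show "compact (F ` K)" using ranked_strict_mono_image[OF K F(1,2)] by (rule ranked_compact)
    show "ranked \<beta> (F ` E')" using ranked_strict_mono_image[OF E' F(1,2)] .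
  qed
qed

lemma precedes_disjoint: "X \<lless> Y \<Longrightarrow> X \<inter> Y = {}"
  unfolding precedes_def by fast

text \<open>Blocks are added on the left. While the set \<open>B\<close> built so far is locally
  below \<open>\<beta>\<close>, a new block of rank \<open>\<beta>\<close> absorbs it, and a block
  of higher rank absorbs it and then splits off a rightmost part of rank \<open>\<beta>\<close>.
  Once such a part exists, further blocks only enlarge \<open>X\<close>.\<close>

lemma locally_below_split:
  fixes \<alpha> \<beta> :: "'a::wellorder"
  assumes P: "compact P" "locally_below \<alpha> P" and u: "\<forall>\<gamma><\<alpha>. order_unique \<gamma>"
  shows "locally_below \<beta> P \<or> (\<exists>X Y. P = X \<union> Y \<and> X \<lless> Y \<and> compact X \<and> ranked \<beta> Y)"
  using P
proof (induction rule: locally_below_induct)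
  case empty
  then show ?case by (simp add: locally_below_def)
next
  case (step A B \<gamma>)
  note A = ranked_compact[OF step(2)]
  have dis: "B \<inter> A = {}" using precedes_disjoint[OF step(4)] by auto
  from step(5) show ?case
  proof (elim disjE exE conjE)
    assume B: "locally_below \<beta> B"
    consider "\<gamma> < \<beta>" | "\<gamma> = \<beta>" | "\<beta> < \<gamma>" by (rule linorder_cases)
    then show ?thesis
    proof cases
      case 1
      then have "locally_below \<beta> (A \<union> B)"
        using locally_below_Un ranked_imp_locally_below step(2,3) A B dis by (metis Int_commute)
      then show ?thesis ..
    next
      case 2
      then have "ranked \<beta> (B \<union> A)" using ranked_Un[OF _ B step(3) dis] step(2) by simp
      then show ?thesis by (intro disjI2 exI[of _ "{}"] exI[of _ "B \<union> A"]) (auto simp: precedes_def)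
    next
      case 3
      then have "ranked \<gamma> (B \<union> A)"
        using ranked_Un[OF step(2) locally_below_mono[OF B] step(3) dis] by simp
      from ranked_absorb_split[OF this u[rule_format, OF step(1)] 3]
      obtain X Y where "B \<union> A = X \<union> Y" "X \<lless> Y" "compact X" "ranked \<beta> Y" .
      then show ?thesis by (metis sup.commute)
    qed
  next
    fix X Y assume XY: "B = X \<union> Y" "X \<lless> Y" "compact X" "ranked \<beta> Y"
    have "A \<union> B = (A \<union> X) \<union> Y" "A \<union> X \<lless> Y" "compact (A \<union> X)"
      using XY step(4) A by (auto simp: precedes_def)
    then show ?thesis using XY by blast
  qed
qed

text \<open>Some section contains a clopen part of rank \<open>\<beta>\<close> and therefore is not
  locally below \<open>\<beta>\<close>; the splitting lemma then provides an outermost block of rank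
  exactly \<open>\<beta>\<close>.\<close>

lemma tail_chunk:
  assumes t: "tail \<alpha> b H" and \<beta>: "\<beta> < \<alpha>" and u: "\<forall>\<gamma><\<alpha>. order_unique \<gamma>"
  obtains p where "b < p" "p \<notin> H" "ranked \<beta> (H \<inter> {p..})"
proof -
  obtain c D where c: "b < c" "c \<notin> H" and D: "ranked \<beta> D" "clopen_part D (H \<inter> {c..})"
    using tailD(5)[OF t \<beta>, of "b + 1"] by auto
  have nloc: "\<not> locally_below \<beta> (H \<inter> {c..})"
    using ranked_not_locally_below D locally_below_clopen_part by blast
  obtain X Y where XY: "H \<inter> {c..} = X \<union> Y" "X \<lless> Y" "compact X" "ranked \<beta> Y"
    using locally_below_split[OF tailD(3,4)[OF t c] u, of \<beta>] nloc by blast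
  obtain p where p: "\<forall>x\<in>X. x < p" "\<forall>y\<in>Y. p < y"
    using precedes_cut[OF XY(3) ranked_compact[OF XY(4)] XY(2)] .
  show ?thesis
  \<comment> \<open>If \<open>X\<close> is empty, \<open>p\<close> may lie to the left of
    \<open>c\<close>; the maximum keeps the cut within the section.\<close>
  proof (rule that[of "max p c"])
    show "b < max p c" using c by auto
    show "max p c \<notin> H"
    proof
      assume m: "max p c \<in> H"
      then have "c < p" using c(2) by (cases "c < p") (simp_all add: max_def split: if_splits)
      then have "p \<in> X \<union> Y" using m unfolding XY(1)[symmetric] by simp
      then show False using p by (metis UnE less_irrefl)
    qed
    have "H \<inter> {max p c..} = (X \<union> Y) \<inter> {p..}" unfolding XY(1)[symmetric] by auto
    also have "\<dots> = Y" using p by force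
    finally show "ranked \<beta> (H \<inter> {max p c..})" using XY(4) by simp
  qed
qed

text \<open>One direction of the back and forth. The blocks of \<open>P\<close> are treated from
  right to left; each is matched with the outermost block of the same rank in what is left of the
  tail, by uniqueness for that smaller rank.\<close>

lemma tail_match:
  assumes P: "compact P" "locally_below \<alpha> P"
    and t: "tail \<alpha> b H" and u: "\<forall>\<gamma><\<alpha>. order_unique \<gamma>"
  shows "\<exists>p>b. p \<notin> H \<and> P \<cong>\<^sub>o H \<inter> {p..}"
  using P
proof (induction rule: locally_below_induct)
  case empty
  obtain d where d: "b < d" "\<forall>x\<in>H. x < d" using tail_bound[OF t] .
  then have "H \<inter> {d..} = {}" "d \<notin> H" by force+
  then show ?case using d(1) order_iso_sets_refl[of "{}"] by (intro exI[of _ d]) simp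
next
  case (step A B \<beta>)
  then obtain p where p: "b < p" "p \<notin> H" "B \<cong>\<^sub>o H \<inter> {p..}" by blast
  obtain r where r: "b < r" "r \<notin> H \<inter> {..p}" "ranked \<beta> (H \<inter> {..p} \<inter> {r..})"
    using tail_chunk[OF tail_restrict[OF t p(1,2)] step(1) u] by blast
  have "r \<le> p" using r(3) ranked_clopen_parts[OF r(3)] by force
  then have rH: "r \<notin> H" using r(2) by auto
  have "A \<cong>\<^sub>o H \<inter> {..p} \<inter> {r..}" using u step(1,2) r(3) by (simp add: order_unique_def)
  moreover have "H \<inter> {..p} \<inter> {r..} \<lless> H \<inter> {p..}" using p(2) by (auto simp: precedes_def order_le_less)
  ultimately have "A \<union> B \<cong>\<^sub>o H \<inter> {..p} \<inter> {r..} \<union> H \<inter> {p..}"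
    using order_iso_sets_Un step(4) p(3) by blast
  also have "H \<inter> {..p} \<inter> {r..} \<union> H \<inter> {p..} = H \<inter> {r..}" using \<open>r \<le> p\<close> by auto
  finally show ?case using r(1) rH by blast
qed

text \<open>One full round: a section of \<open>H\<close> is matched into \<open>H'\<close>, then a
  further part of \<open>H'\<close> is matched back into the rest of \<open>H\<close>, so that the
  cuts on both sides pass below the prescribed bounds.\<close>

lemma tail_step:
  assumes t: "tail \<alpha> b H" and t': "tail \<alpha> b' H'" and u: "\<forall>\<gamma><\<alpha>. order_unique \<gamma>"
    and d: "b < d" "b' < d'"
  obtains c c' where "b < c" "c < d" "c \<notin> H" "b' < c'" "c' < d'" "c' \<notin> H'" "H \<inter> {c..} \<cong>\<^sub>o H' \<inter> {c'..}"
proof -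
  obtain p where p: "b < p" "p < d" "p \<notin> H" using tailD(2)[OF t d(1)] by blast
  obtain p' where p': "b' < p'" "p' \<notin> H'" "H \<inter> {p..} \<cong>\<^sub>o H' \<inter> {p'..}"
    using tail_match[OF tailD(3,4)[OF t p(1,3)] t' u] by blast
  obtain c' where c': "b' < c'" "c' < min d' p'" "c' \<notin> H'"
    using tailD(2)[OF t', of "min d' p'"] d p' by auto
  note r = tail_restrict[OF t p(1,3)] and r' = tail_restrict[OF t' p'(1,2)]
  have c'2: "c' \<notin> H' \<inter> {..p'}" using c' by auto
  obtain q where q: "b < q" "q \<notin> H \<inter> {..p}" "H' \<inter> {..p'} \<inter> {c'..} \<cong>\<^sub>o H \<inter> {..p} \<inter> {q..}"
    using tail_match[OF tailD(3,4)[OF r' c'(1) c'2] r u] by blast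
  \<comment> \<open>If the block matched last is empty, \<open>q\<close> may lie beyond
    \<open>p\<close>; the minimum is then the right cut.\<close>
  define c where "c = min q p"
  have c: "b < c" "c < d" "c \<notin> H" using p q by (auto simp: c_def min_def)
  have "H \<inter> {..p} \<inter> {q..} = H \<inter> {..p} \<inter> {c..}" using p(3) by (auto simp: c_def min_def order_le_less)
  then have "H \<inter> {..p} \<inter> {c..} \<cong>\<^sub>o H' \<inter> {..p'} \<inter> {c'..}" using order_iso_sets_sym q(3) by simp
  moreover have "H \<inter> {..p} \<inter> {c..} \<lless> H \<inter> {p..}" "H' \<inter> {..p'} \<inter> {c'..} \<lless> H' \<inter> {p'..}"
    using p(3) p'(2) by (auto simp: precedes_def order_le_less)
  ultimately have "H \<inter> {..p} \<inter> {c..} \<union> H \<inter> {p..} \<cong>\<^sub>o H' \<inter> {..p'} \<inter> {c'..} \<union> H' \<inter> {p'..}"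
    using order_iso_sets_Un p'(3) by blast
  moreover have "H \<inter> {..p} \<inter> {c..} \<union> H \<inter> {p..} = H \<inter> {c..}" by (auto simp: c_def)
  moreover have "H' \<inter> {..p'} \<inter> {c'..} \<union> H' \<inter> {p'..} = H' \<inter> {c'..}" using c' by auto
  ultimately show ?thesis using that c c' by auto
qed

lemma decseq_block:
  fixes c :: "nat \<Rightarrow> real"
  assumes "c n \<le> x" obtains m where "c m \<le> x" "m = 0 \<or> x < c (m - 1)"
proof -
  let ?m = "LEAST n. c n \<le> x"
  have "c ?m \<le> x" using assms by (rule LeastI)
  moreover have "?m = 0 \<or> x < c (?m - 1)"
    using not_less_Least[of "?m - 1" "\<lambda>n. c n \<le> x"] by (cases "?m = 0") (simp_all add: not_le)
  ultimately show ?thesis using that by blast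
qed

text \<open>Blocks are numbered from right to left, starting with the outer section. Consecutive
  ones share a cut, which does no harm because the cuts are taken outside \<open>H\<close>.\<close>

definition block :: "(nat \<Rightarrow> real) \<Rightarrow> real set \<Rightarrow> nat \<Rightarrow> real set" where
  "block c H n = (if n = 0 then H \<inter> {c 0..} else H \<inter> {c n..c (n - 1)})"

lemma block_precedes:
  assumes "decseq c" "\<And>n. c n \<notin> H" "i < j" shows "block c H j \<lless> block c H i"
proof -
  have "block c H i \<subseteq> H \<inter> {c i..}" by (auto simp: block_def)
  moreover have "block c H j \<subseteq> H \<inter> {..c i}"
  proof -
    have "c (j - 1) \<le> c i" using decseqD[OF assms(1), of i "j - 1"] assms(3) by simp
    then show ?thesis using assms(3) by (auto simp: block_def)
  qed
  moreover have "H \<inter> {..c i} \<lless> H \<inter> {c i..}"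
    using assms(2)[of i] by (auto simp: precedes_def order_le_less)
  ultimately show ?thesis unfolding precedes_def by blast
qed

lemma UN_block:
  assumes "\<And>x. x \<in> H \<Longrightarrow> \<exists>n. c n \<le> x" shows "(\<Union>n. block c H n) = H"
proof
  show "(\<Union>n. block c H n) \<subseteq> H" by (auto simp: block_def split: if_splits)
  show "H \<subseteq> (\<Union>n. block c H n)"
  proof
    fix x assume x: "x \<in> H"
    then obtain n where "c n \<le> x" using assms by blast
    then obtain m where "c m \<le> x" "m = 0 \<or> x < c (m - 1)" by (rule decseq_block)
    then have "x \<in> block c H m" using x by (auto simp: block_def)
    then show "x \<in> (\<Union>n. block c H n)" by blast
  qed
qed

text \<open>Back and forth: each step cuts off matching blocks of both tails that reach closer to the
  respective limit points, so the blocks exhaust both tails.\<close>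

lemma tail_order_iso:
  assumes t: "tail \<alpha> b H" and t': "tail \<alpha> b' H'" and u: "\<forall>\<gamma><\<alpha>. order_unique \<gamma>"
  shows "H \<cong>\<^sub>o H'"
proof -
  \<comment> \<open>At stage \<open>n\<close> both cuts are within \<open>1 / (n + 1)\<close> of
    their limit points. Stage 0 matches the outer sections; every later stage matches, through
    \<open>nxt\<close>, the blocks between old and new cuts.\<close>
  define good where "good n z \<longleftrightarrow> (case z of (c, c') \<Rightarrow>
      b < c \<and> c < b + inverse (real (Suc n)) \<and> c \<notin> H \<and> b' < c' \<and> c' < b' + inverse (real (Suc n)) \<and> c' \<notin> H' \<and>
      (n = 0 \<longrightarrow> H \<inter> {c..} \<cong>\<^sub>o H' \<inter> {c'..}))" for n z
  define nxt where "nxt z w \<longleftrightarrow> fst w < fst z \<and> snd w < snd z \<and>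
      H \<inter> {fst w..fst z} \<cong>\<^sub>o H' \<inter> {snd w..snd z}" for z w :: "real \<times> real"
  have "\<exists>z. good 0 z"
    using tail_step[OF t t' u, of "b + 1" "b' + 1"] by (simp add: good_def) metis
  moreover have "\<exists>w. good (Suc n) w \<and> nxt z w" if "good n z" for z n
  proof -
    obtain c c' where z: "z = (c, c')" by (cases z)
    have c: "b < c" "c \<notin> H" "b' < c'" "c' \<notin> H'" using that by (auto simp: good_def z)
    obtain d d' where d: "b < d" "d < min c (b + inverse (real (Suc (Suc n))))" "d \<notin> H \<inter> {..c}"
      "b' < d'" "d' < min c' (b' + inverse (real (Suc (Suc n))))" "d' \<notin> H' \<inter> {..c'}"
      "H \<inter> {..c} \<inter> {d..} \<cong>\<^sub>o H' \<inter> {..c'} \<inter> {d'..}"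
      by (rule tail_step[OF tail_restrict[OF t c(1,2)] tail_restrict[OF t' c(3,4)] u,
            of "min c (b + inverse (real (Suc (Suc n))))" "min c' (b' + inverse (real (Suc (Suc n))))"])
        (use c in auto)
    moreover have "H \<inter> {..c} \<inter> {d..} = H \<inter> {d..c}" "H' \<inter> {..c'} \<inter> {d'..} = H' \<inter> {d'..c'}" by auto
    ultimately have "good (Suc n) (d, d') \<and> nxt z (d, d')"
      by (simp add: good_def nxt_def z)
    then show ?thesis ..
  qed
  ultimately obtain z where z: "\<And>n. good n (z n)" "\<And>n. nxt (z n) (z (Suc n))"
    using dependent_nat_choice[of good "\<lambda>n. nxt"] by metis
  define c where "c n = fst (z n)" for n
  define c' where "c' n = snd (z n)" for n
  have c: "c n < b + inverse (real (Suc n))" "c n \<notin> H" "c' n < b' + inverse (real (Suc n))" "c' n \<notin> H'"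
    "H \<inter> {c 0..} \<cong>\<^sub>o H' \<inter> {c' 0..}" for n
    using z(1)[of n] z(1)[of 0] by (auto simp: good_def c_def c'_def split: prod.splits)
  have n: "c (Suc n) < c n" "c' (Suc n) < c' n" "H \<inter> {c (Suc n)..c n} \<cong>\<^sub>o H' \<inter> {c' (Suc n)..c' n}" for n
    using z(2)[of n] by (auto simp: nxt_def c_def c'_def)
  have dec: "decseq c" "decseq c'" using n by (auto intro!: decseq_SucI less_imp_le)
  have ex: "\<exists>n. v n \<le> x" if ex: "e < x" "\<And>n. v n < e + inverse (real (Suc n))" for x e :: real and v
  proof -
    obtain n where "inverse (real (Suc n)) < x - e" using reals_Archimedean[of "x - e"] ex(1) by auto
    then show ?thesis using ex(2)[of n] by (intro exI[of _ n]) simp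
  qed
  have "(\<Union>n. block c H n) \<cong>\<^sub>o (\<Union>n. block c' H' n)"
  proof (rule order_iso_sets_UN)
    show "block c H i \<cong>\<^sub>o block c' H' i" for i
      using c(5) n(3)[of "i - 1"] by (cases i) (auto simp: block_def)
    show "block c H i \<lless> block c H j \<and> block c' H' i \<lless> block c' H' j \<or>
        block c H j \<lless> block c H i \<and> block c' H' j \<lless> block c' H' i" if "i \<noteq> j" for i j
      using block_precedes[OF dec(1), of H] block_precedes[OF dec(2), of H'] c(2,4) that
      by (metis linorder_neqE_nat)
  qed
  moreover have "(\<Union>n. block c H n) = H"
    by (rule UN_block) (use ex[OF tailD(1)[OF t] c(1)] in blast)
  moreover have "(\<Union>n. block c' H' n) = H'"
    by (rule UN_block) (use ex[OF tailD(1)[OF t'] c(3)] in blast)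
  ultimately show ?thesis by simp
qed

subsection \<open>Uniqueness of the order type\<close>

text \<open>The premises of the introduction rule of \<open>ranked\<close> with the two ends
  exposed, so that both tails refer to the same interval.\<close>

definition main_interval :: "'a::wellorder \<Rightarrow> real set \<Rightarrow> real \<Rightarrow> real \<Rightarrow> bool" where
  "main_interval \<alpha> K a b \<longleftrightarrow> compact K \<and> a < b \<and> {a..b} \<subseteq> K \<and>
    (\<forall>x\<in>K - {a..b}. \<exists>\<beta> D. \<beta> < \<alpha> \<and> ranked \<beta> D \<and> x \<in> D \<and> D \<subseteq> K - {a..b} \<and> clopen_part D K) \<and>
    (\<forall>\<beta><\<alpha>. \<forall>e\<in>{a,b}. \<forall>\<epsilon>>0. \<exists>D. ranked \<beta> D \<and> D \<subseteq> ball e \<epsilon> - {a..b} \<and> clopen_part D K)"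

lemma main_interval_exists: "ranked \<alpha> K \<Longrightarrow> \<exists>a b. main_interval \<alpha> K a b"
  unfolding main_interval_def by (erule ranked.cases) blast

lemma clopen_part_uminus:
  assumes "clopen_part D K" shows "clopen_part (uminus ` D) (uminus ` K)"
proof -
  have "uminus ` K - uminus ` D = uminus ` (K - D)" by auto
  then show ?thesis using assms by (auto simp: clopen_part_def intro: compact_negations)
qed

text \<open>Reflection exchanges the ends, so the part left of the main interval becomes a right
  tail.\<close>

lemma main_interval_uminus:
  assumes "main_interval \<alpha> K a b" shows "main_interval \<alpha> (uminus ` K) (- b) (- a)"
  unfolding main_interval_def
proof (intro conjI ballI allI impI)
  note K = assms[unfolded main_interval_def]
  show "compact (uminus ` K)" using K by (simp add: compact_negations)
  show "- b < - a" using K by simp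
  have J: "{- b..- a} = uminus ` {a..b}" by simp
  then show "{- b..- a} \<subseteq> uminus ` K" using K by (metis image_mono)
  fix x assume "x \<in> uminus ` K - {- b..- a}"
  then have "- x \<in> K - {a..b}" by auto
  then obtain \<beta> D where D: "\<beta> < \<alpha>" "ranked \<beta> D" "- x \<in> D" "D \<subseteq> K - {a..b}" "clopen_part D K"
    using K by blast
  have "uminus ` D \<subseteq> uminus ` K - {- b..- a}" using D(4) unfolding J by auto
  moreover have "x \<in> uminus ` D" using D(3) by (metis add.inverse_inverse imageI)
  ultimately show "\<exists>\<beta> D. \<beta> < \<alpha> \<and> ranked \<beta> D \<and> x \<in> D \<and> D \<subseteq> uminus ` K - {- b..- a} \<and> clopen_part D (uminus ` K)"
    using D(1) ranked_uminus[OF D(2)] clopen_part_uminus[OF D(5)] by blast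
next
  note K = assms[unfolded main_interval_def]
  fix \<beta> e and \<epsilon> :: real assume *: "\<beta> < \<alpha>" "e \<in> {- b, - a}" "0 < \<epsilon>"
  then have "- e \<in> {a, b}" by auto
  then obtain D where D: "ranked \<beta> D" "D \<subseteq> ball (- e) \<epsilon> - {a..b}" "clopen_part D K"
    using K *(1,3) by blast
  have "- z \<in> ball e \<epsilon> - {- b..- a}" if "z \<in> D" for z
  proof -
    have "z \<in> ball (- e) \<epsilon>" "z \<notin> {a..b}" using D(2) that by blast+
    then show ?thesis by (auto simp: dist_real_def abs_minus_commute abs_if split: if_splits)
  qed
  then have "uminus ` D \<subseteq> ball e \<epsilon> - {- b..- a}" by blast
  then show "\<exists>D. ranked \<beta> D \<and> D \<subseteq> ball e \<epsilon> - {- b..- a} \<and> clopen_part D (uminus ` K)"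
    using ranked_uminus[OF D(1)] clopen_part_uminus[OF D(3)] by blast
qed

lemma main_interval_tail:
  assumes "main_interval \<alpha> K a b" shows "tail \<alpha> b (K \<inter> {b<..})"
proof -
  note K = assms[unfolded main_interval_def]
  then have comp: "compact K" and ab: "a < b" "{a..b} \<subseteq> K" by auto
  have gap: "\<exists>c>b. c < d \<and> c \<notin> K \<inter> {b<..}" if "b < d" for d
  proof (rule ccontr)
    \<comment> \<open>Without a gap, \<open>{b..x}\<close> would lie in \<open>K\<close>. Being
      connected, it would lie in the clopen part around \<open>x\<close>, which misses
      \<open>b\<close>.\<close>
    assume no: "\<not> ?thesis"
    define x where "x = (b + d) / 2"
    have bx: "b < x" "x < d" using that by (auto simp: x_def)
    then have "x \<in> K - {a..b}" using no by auto
    then obtain D where D: "x \<in> D" "D \<subseteq> K - {a..b}" "clopen_part D K" using K by blast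
    have "{b..x} \<subseteq> K"
    proof
      fix y assume "y \<in> {b..x}"
      then show "y \<in> K" using no bx ab by (cases "y = b") auto
    qed
    then have "{b..x} \<subseteq> D"
      using connected_clopen_part[of "{b..x}" K D x] D bx by auto
    moreover have "b \<in> {b..x}" "b \<in> {a..b}" using bx ab by auto
    ultimately show False using D(2) by blast
  qed
  have clop: "H = K \<inter> {c..} \<and> clopen_part H K"
    if "b < c" "c \<notin> K \<inter> {b<..}" "H = K \<inter> {b<..} \<inter> {c..}" for c H
  proof -
    have "H = K \<inter> {c..}" "c \<notin> K" using that by auto
    then show ?thesis using clopen_part_atLeast[OF comp] by simp
  qed
  show ?thesis unfolding tail_def
  proof (intro conjI allI impI ballI)
    show "b < x" if "x \<in> K \<inter> {b<..}" for x using that by simp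
    show "\<exists>c>b. c < d \<and> c \<notin> K \<inter> {b<..}" if "b < d" for d using gap that by blast
    fix c assume c: "b < c" "c \<notin> K \<inter> {b<..}"
    note H = clop[OF c refl]
    show "compact (K \<inter> {b<..} \<inter> {c..})" using H unfolding clopen_part_def by blast
    show "locally_below \<alpha> (K \<inter> {b<..} \<inter> {c..})"
    proof (rule locally_below_clopen_partI)
      show "clopen_part (K \<inter> {b<..} \<inter> {c..}) K" using H by blast
      show "\<exists>\<beta> E. \<beta> < \<alpha> \<and> ranked \<beta> E \<and> x \<in> E \<and> clopen_part E K" if "x \<in> K \<inter> {b<..} \<inter> {c..}" for x
      proof -
        have "x \<in> K - {a..b}" using that by auto
        then show ?thesis using K by blast
      qed
    qed
  next
    fix \<beta> d assume \<beta>: "\<beta> < \<alpha>" and d: "b < d"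
    \<comment> \<open>The bound \<open>b - a\<close> keeps the ball from reaching past
      \<open>a\<close>, so \<open>D\<close> lies to the right of \<open>b\<close>.\<close>
    have pos: "0 < min (d - b) (b - a)" using d ab by simp
    obtain D where D: "ranked \<beta> D" "D \<subseteq> ball b (min (d - b) (b - a)) - {a..b}" "clopen_part D K"
      using K \<beta> pos by (metis insertI1 insertI2)
    have Dbd: "b < z \<and> z < d" if "z \<in> D" for z
    proof -
      have "z \<in> ball b (min (d - b) (b - a))" "z \<notin> {a..b}" using D(2) that by blast+
      then show ?thesis by (auto simp: dist_real_def abs_if split: if_splits)
    qed
    \<comment> \<open>\<open>D\<close> is compact and lies to the right of \<open>b\<close>, which
      leaves room for a cut between \<open>b\<close> and \<open>D\<close>.\<close>
    obtain p where p: "b < p" "\<forall>y\<in>D. p < y"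
      using precedes_cut[of "{b}" D] ranked_compact[OF D(1)] Dbd by (metis compact_sing insertI1 precedes_def singletonD)
    obtain c where c: "b < c" "c < p" "c \<notin> K \<inter> {b<..}" using gap[OF p(1)] by blast
    note H = clop[OF c(1,3) refl]
    have "D \<subseteq> K" using D(3) by (simp add: clopen_part_def)
    then have "D \<subseteq> K \<inter> {b<..} \<inter> {c..}" using p(2) c Dbd by force
    then have "clopen_part D (K \<inter> {b<..} \<inter> {c..})"
      using clopen_part_subset[OF D(3)] H unfolding clopen_part_def by blast
    moreover have "D \<subseteq> {..<d}" using Dbd by auto
    ultimately show "\<exists>c D. b < c \<and> c \<notin> K \<inter> {b<..} \<and> ranked \<beta> D \<and>
        clopen_part D (K \<inter> {b<..} \<inter> {c..}) \<and> D \<subseteq> {..<d}"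
      using c D(1) by blast
  qed
qed

text \<open>Left tail, main interval and right tail are matched separately and glued; the induction
  hypothesis is what the matching of the tails requires.\<close>

lemma order_unique: "order_unique \<alpha>"
proof (induction \<alpha> rule: less_induct)
  case (less \<alpha>)
  then have u: "\<forall>\<gamma><\<alpha>. order_unique \<gamma>" by blast
  show ?case unfolding order_unique_def
  proof (intro allI impI)
    fix K K' assume "ranked \<alpha> K" "ranked \<alpha> K'"
    then obtain a b a' b' where m: "main_interval \<alpha> K a b" "main_interval \<alpha> K' a' b'"
      using main_interval_exists by metis
    have ab: "a < b" "{a..b} \<subseteq> K" "a' < b'" "{a'..b'} \<subseteq> K'" using m by (auto simp: main_interval_def)
    have right: "K \<inter> {b<..} \<cong>\<^sub>o K' \<inter> {b'<..}"
      by (rule tail_order_iso[OF main_interval_tail[OF m(1)] main_interval_tail[OF m(2)] u])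
    have "uminus ` K \<inter> {- a<..} \<cong>\<^sub>o uminus ` K' \<inter> {- a'<..}"
      by (rule tail_order_iso[OF main_interval_tail[OF main_interval_uminus[OF m(1)]]
            main_interval_tail[OF main_interval_uminus[OF m(2)]] u])
    from order_iso_sets_uminus[OF this]
    have "uminus ` (uminus ` K \<inter> {- a<..}) \<cong>\<^sub>o uminus ` (uminus ` K' \<inter> {- a'<..})" .
    moreover have "uminus ` (uminus ` S \<inter> {- c<..}) = S \<inter> {..<c}" for S :: "real set" and c
      by (force simp: image_iff)
    ultimately have left: "K \<inter> {..<a} \<cong>\<^sub>o K' \<inter> {..<a'}" by simp
    have "{a..b} \<union> K \<inter> {b<..} \<cong>\<^sub>o {a'..b'} \<union> K' \<inter> {b'<..}"
      by (rule order_iso_sets_Un[OF order_iso_sets_cbox right]) (use ab in \<open>auto simp: precedes_def\<close>)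
    then have "K \<inter> {..<a} \<union> ({a..b} \<union> K \<inter> {b<..}) \<cong>\<^sub>o K' \<inter> {..<a'} \<union> ({a'..b'} \<union> K' \<inter> {b'<..})"
      by (rule order_iso_sets_Un[OF left]) (use ab in \<open>auto simp: precedes_def\<close>)
    moreover have "K \<inter> {..<a} \<union> ({a..b} \<union> K \<inter> {b<..}) = K" using ab by auto
    moreover have "K' \<inter> {..<a'} \<union> ({a'..b'} \<union> K' \<inter> {b'<..}) = K'" using ab by auto
    ultimately show "K \<cong>\<^sub>o K'" by simp
  qed
qed

section \<open>Ranked sets are regularly closed t-sets\<close>

text \<open>The copy has the same rank, hence the same order type. The homeomorphism of the line
  comes from the increasing bijection and need not extend the given homeomorphism of
  \<open>A\<close> and \<open>Y\<close>.\<close>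

lemma ranked_t_set:
  assumes A: "ranked \<alpha> A" shows "t_set A"
  unfolding t_set_def
proof (intro allI impI)
  fix Y :: "real set" assume "Y homeomorphic A"
  then obtain f g where "homeomorphism A Y f g" using homeomorphic_sym homeomorphic_def by metis
  then have Y: "ranked \<alpha> Y" by (rule ranked_homeomorphism[OF A])
  then have "A \<cong>\<^sub>o Y" using order_unique A unfolding order_unique_def by blast
  then obtain F where "strict_mono F" "surj F" "F ` A = Y"
    using order_iso_sets_extension ranked_compact A Y by metis
  then show "\<exists>f g. homeomorphism (UNIV :: real set) (UNIV :: real set) f g \<and> f ` A = Y"
    using strict_mono_surj_homeomorphism by blast
qed

lemma ranked_interval:
  assumes "ranked \<alpha> K" "x \<in> K" shows "\<exists>a b. a < b \<and> x \<in> {a..b} \<and> {a..b} \<subseteq> K"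
  using assms
proof (induction arbitrary: x)
  case (ranked K a b \<alpha>)
  show ?case
  proof (cases "x \<in> {a..b}")
    case True then show ?thesis using ranked.hyps by blast
  next
    case False
    then obtain D where "x \<in> D" "D \<subseteq> K - {a..b}" "\<forall>x\<in>D. \<exists>a b. a < b \<and> x \<in> {a..b} \<and> {a..b} \<subseteq> D"
      using ranked.IH(1) ranked.prems by (metis (no_types, lifting) DiffI)
    then show ?thesis by (meson Diff_subset order_trans)
  qed
qed

lemma ranked_regularly_closed:
  assumes "ranked \<alpha> K" shows "regularly_closed K"
  unfolding regularly_closed_def
proof
  show "closed K" using ranked_compact[OF assms] by (rule compact_imp_closed)
  \<comment> \<open>Every point lies in a non-degenerate interval inside \<open>K\<close>, so the
    non-trivial components cover \<open>K\<close>, which is more than density.\<close>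
  have "K \<subseteq> \<Union>{C \<in> components K. \<exists>x\<in>C. \<exists>y\<in>C. x \<noteq> y}"
  proof
    fix x assume x: "x \<in> K"
    then obtain a b where ab: "a < b" "x \<in> {a..b}" "{a..b} \<subseteq> K" using ranked_interval[OF assms] by blast
    let ?C = "connected_component_set K x"
    have C: "?C \<in> components K" using x by (simp add: components_def)
    have sub: "{a..b} \<subseteq> ?C" using ab by (intro connected_component_maximal) auto
    have "a \<in> {a..b}" "b \<in> {a..b}" using ab(1) by auto
    then have "\<exists>y\<in>?C. \<exists>z\<in>?C. y \<noteq> z" "x \<in> ?C" using sub ab(1,2) by (metis less_irrefl subsetD)+
    then show "x \<in> \<Union>{C \<in> components K. \<exists>x\<in>C. \<exists>y\<in>C. x \<noteq> y}"
      using C by blast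
  qed
  then show "K \<subseteq> closure (\<Union>{C \<in> components K. \<exists>x\<in>C. \<exists>y\<in>C. x \<noteq> y})"
    using closure_subset by (rule subset_trans)
qed

subsection \<open>Existence\<close>

lemma ranked_rescale:
  assumes E: "ranked \<beta> E" and lu: "l < u"
  obtains D where "ranked \<beta> D" "D \<subseteq> {l<..<u}"
proof -
  obtain M where M: "0 < M" "\<And>x. x \<in> E \<Longrightarrow> \<bar>x\<bar> \<le> M"
    using compact_imp_bounded[OF ranked_compact[OF E]] unfolding bounded_pos by auto
  define r where "r = (u - l) / (4 * M)"
  have r: "0 < r" "r * M = (u - l) / 4" using lu M(1) by (auto simp: r_def)
  have "r * x + (l + u) / 2 \<in> {l<..<u}" if "x \<in> E" for x
  proof -
    have "\<bar>r * x\<bar> \<le> r * M" using M(2)[OF that] r(1) by (simp add: abs_mult)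
    then show ?thesis using r(2) lu by (auto simp: abs_le_iff field_simps)
  qed
  then have "(\<lambda>x. r * x + (l + u) / 2) ` E \<subseteq> {l<..<u}" by blast
  moreover have "ranked \<beta> ((\<lambda>x. r * x + (l + u) / 2) ` E)"
    using ranked_affine[OF E] r(1) by simp
  ultimately show ?thesis using that by blast
qed

text \<open>Copies of sets of all smaller ranks, each rank occurring infinitely often, are lined up
  towards \<open>1\<close> and mirrored towards \<open>-1\<close>, around the main interval
  \<open>{-1..1}\<close>. Countability allows the smaller ranks to be listed in a sequence.\<close>

lemma ranked_exists:
  fixes \<alpha> :: "'a::wellorder"
  assumes "countable {..<\<alpha>}" shows "\<exists>K. ranked \<alpha> K"
  using assms
proof (induction \<alpha> rule: less_induct)
  case (less \<alpha>)
  show ?case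
  proof (cases "{..<\<alpha>} = {}")
    case True
    then have "\<not> \<beta> < \<alpha>" for \<beta> by auto
    then have "ranked \<alpha> {0..1}" by (intro ranked.ranked[of _ 0 1]) auto
    then show ?thesis ..
  next
    case False
    \<comment> \<open>Decoding pairs makes every rank occur at arbitrarily large indices, since
      \<open>prod_encode (i, k)\<close> is at least \<open>k\<close>.\<close>
    define e where "e n = from_nat_into {..<\<alpha>} (fst (prod_decode n))" for n
    have e: "e n < \<alpha>" for n using from_nat_into[OF False] by (simp add: e_def)
    have e_often: "\<exists>n\<ge>k. e n = \<beta>" if "\<beta> < \<alpha>" for \<beta> k
    proof -
      obtain i where "from_nat_into {..<\<alpha>} i = \<beta>"
        using from_nat_into_surj[OF less.prems, of \<beta>] \<open>\<beta> < \<alpha>\<close> by auto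
      then have "e (prod_encode (i, k)) = \<beta>" by (simp add: e_def)
      then show ?thesis using le_prod_encode_2 by blast
    qed
    have "countable {..<e n}" for n
      by (rule countable_subset[OF _ less.prems]) (use e[of n] in auto)
    then have ex: "\<exists>K. ranked (e n) K" for n using less.IH e by blast
    \<comment> \<open>The cuts decrease to \<open>1\<close>; the piece \<open>D n\<close> goes
      strictly between \<open>v (Suc n)\<close> and \<open>v n\<close>.\<close>
    define v where "v n = 1 + inverse (real (Suc n))" for n
    have v_less: "v n < v m" if "m < n" for m n using that by (simp add: v_def)
    have v_le: "v n \<le> v m" if "m \<le> n" for m n using that by (simp add: v_def)
    have v1: "1 < v n" "v n \<le> 2" for n by (simp_all add: v_def inverse_eq_divide)
    have "\<exists>D. ranked (e n) D \<and> D \<subseteq> {v (Suc n)<..<v n}" for n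
      using ex[of n] ranked_rescale v_less[of n "Suc n"] by (metis lessI)
    then obtain D where D: "\<And>n. ranked (e n) (D n)" "\<And>n. D n \<subseteq> {v (Suc n)<..<v n}" by metis
    have Dv: "v (Suc n) < x" "x < v n" if "x \<in> D n" for n x using D(2)[of n] that by auto
    have Dm: "m = n" if "x \<in> D m" "v (Suc n) \<le> x" "x \<le> v n" for m n x
    proof (rule ccontr)
      assume "m \<noteq> n"
      then consider "Suc m \<le> n" | "Suc n \<le> m" by linarith
      then show False using Dv[OF that(1)] v_le[of "Suc m" n] v_le[of "Suc n" m] that by cases auto
    qed
    define X where "X = (\<Union>n. D n)"
    have vX: "v n \<notin> X" for n
    proof
      assume "v n \<in> X"
      then obtain m where m: "v n \<in> D m" by (auto simp: X_def)
      then have "m = n" using Dm[OF m, of n] v_le[of n "Suc n"] by simp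
      then show False using Dv[OF m] by simp
    qed
    have X1: "1 < x" "x < 2" if x: "x \<in> X" for x
    proof -
      obtain n where "x \<in> D n" using x by (auto simp: X_def)
      then show "1 < x" "x < 2" using Dv[of x n] v1[of n] v1[of "Suc n"] by auto
    qed
    \<comment> \<open>Closedness: to the right of \<open>v m\<close> only the finitely many pieces
      with index below \<open>m\<close> occur, so the complement is a union of open sets.\<close>
    have "- insert 1 X = {..<1} \<union> (\<Union>m. {v m<..} - (\<Union>n<m. D n))"
    proof (intro set_eqI iffI)
      fix x assume x: "x \<in> - insert 1 X"
      show "x \<in> {..<1} \<union> (\<Union>m. {v m<..} - (\<Union>n<m. D n))"
      proof (cases "x < 1")
        case False
        then have "1 < x" using x by auto
        then obtain m where "inverse (real (Suc m)) < x - 1" using reals_Archimedean[of "x - 1"] by auto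
        then have "x \<in> {v m<..} - (\<Union>n<m. D n)" using x by (auto simp: v_def X_def)
        then show ?thesis by blast
      qed simp
    next
      fix x assume "x \<in> {..<1} \<union> (\<Union>m. {v m<..} - (\<Union>n<m. D n))"
      then consider "x < 1" | m where "v m < x" "\<forall>n<m. x \<notin> D n" by auto
      then show "x \<in> - insert 1 X"
      proof cases
        case 1 then show ?thesis using X1 by force
      next
        case 2
        have "x \<notin> D n" for n
        proof
          assume xn: "x \<in> D n"
          then have "m \<le> n" using 2(2) not_less by blast
          then show False using v_le[of m n] Dv[OF xn] 2(1) by auto
        qed
        then show ?thesis using 2(1) v1(1)[of m] by (auto simp: X_def)
      qed
    qed
    moreover have "open ({..<1} \<union> (\<Union>m. {v m<..} - (\<Union>n<m. D n)))"
      using D(1) by (intro open_Un open_UN ballI open_Diff closed_UN)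
        (auto intro: compact_imp_closed ranked_compact)
    ultimately have "closed (insert 1 X)" by (simp add: closed_def)
    moreover have "bounded (insert 1 X)"
    proof (rule bounded_subset[of "{0..2}"])
      have "x \<in> {0..2}" if "x \<in> X" for x using X1[OF that] by simp
      then show "insert 1 X \<subseteq> {0..2}" by auto
    qed simp
    ultimately have comp1: "compact (insert 1 X)" by (simp add: compact_eq_bounded_closed)
    define K where "K = {-1..1} \<union> insert 1 X \<union> uminus ` insert 1 X"
    have comp: "compact K" unfolding K_def
      by (intro compact_Un compact_negations comp1) simp
    have K_uminus: "uminus ` K = K" by (auto simp: K_def image_Un image_image)
    have K_pos: "x \<in> X \<longleftrightarrow> x \<in> K" if "1 < x" for x
      using that X1 by (force simp: K_def)
    have K_cases: "x \<in> X \<or> - x \<in> X" if "x \<in> K - {-1..1}" for x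
      using that by (auto simp: K_def)
    have Dclop: "clopen_part (D n) K" for n
    proof -
      \<comment> \<open>The cuts are outside \<open>K\<close>, so the section between two
        consecutive ones is clopen, and it is just \<open>D n\<close>.\<close>
      have "D n = K \<inter> {v (Suc n)..v n}"
      proof (intro set_eqI iffI)
        fix x assume x: "x \<in> D n"
        then have "x \<in> X" by (auto simp: X_def)
        then show "x \<in> K \<inter> {v (Suc n)..v n}" using Dv[OF x] K_pos[of x] X1[of x] by auto
      next
        fix x assume x: "x \<in> K \<inter> {v (Suc n)..v n}"
        then have "x \<in> X" using K_pos[of x] v1(1)[of "Suc n"] by auto
        then obtain m where "x \<in> D m" by (auto simp: X_def)
        then show "x \<in> D n" using Dm[of x m n] x by auto
      qed
      moreover have "v k \<notin> K" for k using K_pos[OF v1(1)] vX by blast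
      ultimately show ?thesis using clopen_part_atLeastAtMost[OF comp] by metis
    qed
    have Dclop': "clopen_part (uminus ` D n) K" for n
      using clopen_part_uminus[OF Dclop[of n]] by (simp add: K_uminus)
    have DJ: "D n \<subseteq> K - {-1..1}" "uminus ` D n \<subseteq> K - {-1..1}" for n
    proof -
      have "1 < x" if "x \<in> D n" for x using X1(1)[of x] that by (auto simp: X_def)
      then show "D n \<subseteq> K - {-1..1}" "uminus ` D n \<subseteq> K - {-1..1}"
        using Dclop[of n] Dclop'[of n] by (force simp: clopen_part_def)+
    qed
    have "ranked \<alpha> K"
    proof (rule ranked.ranked[OF comp])
      show "(-1::real) < 1" "{-1..1} \<subseteq> K" by (auto simp: K_def)
      show "\<forall>x\<in>K - {-1..1}. \<exists>\<beta> D. \<beta> < \<alpha> \<and> ranked \<beta> D \<and> x \<in> D \<and> D \<subseteq> K - {-1..1} \<and> clopen_part D K"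
      proof
        fix x assume "x \<in> K - {-1..1}"
        then obtain n where "x \<in> D n \<or> - x \<in> D n" using K_cases by (force simp: X_def)
        then have "x \<in> D n \<or> x \<in> uminus ` D n" by (metis add.inverse_inverse imageI)
        then show "\<exists>\<beta> D. \<beta> < \<alpha> \<and> ranked \<beta> D \<and> x \<in> D \<and> D \<subseteq> K - {-1..1} \<and> clopen_part D K"
          using e[of n] D(1)[of n] ranked_uminus[OF D(1)[of n]] Dclop[of n] Dclop'[of n] DJ[of n] by blast
      qed
      show "\<forall>\<beta><\<alpha>. \<forall>e\<in>{-1,1}. \<forall>\<epsilon>>0. \<exists>D. ranked \<beta> D \<and> D \<subseteq> ball e \<epsilon> - {-1..1} \<and> clopen_part D K"
      proof (intro allI impI ballI)
        fix \<beta> and p \<epsilon> :: real assume *: "\<beta> < \<alpha>" "p \<in> {-1,1}" "0 < \<epsilon>"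
        obtain k where k: "inverse (real (Suc k)) < \<epsilon>" using reals_Archimedean[OF *(3)] by auto
        obtain n where n: "k \<le> n" "e n = \<beta>" using e_often[OF *(1)] by blast
        have "v k < 1 + \<epsilon>" using k by (simp add: v_def)
        then have "v n < 1 + \<epsilon>" using v_le[OF n(1)] by simp
        then have near: "1 < x \<and> x < 1 + \<epsilon>" if "x \<in> D n" for x
          using Dv[OF that] v1(1)[of "Suc n"] by auto
        have "D n \<subseteq> ball 1 \<epsilon>" "uminus ` D n \<subseteq> ball (-1) \<epsilon>"
          using near by (auto simp: dist_real_def dest!: near)
        then show "\<exists>D. ranked \<beta> D \<and> D \<subseteq> ball p \<epsilon> - {-1..1} \<and> clopen_part D K"
          using *(2) n(2) D(1)[of n] ranked_uminus[OF D(1)[of n]] Dclop[of n] Dclop'[of n] DJ[of n] by blast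
      qed
    qed
    then show ?thesis ..
  qed
qed

subsection \<open>The first uncountable ordinal\<close>

text \<open>\<open>cardSuc natLeq\<close> is a well-order of the order type of the first uncountable
  ordinal. Ranks range over a type of class \<open>wellorder\<close>, so its field is made a
  type.\<close>

typedef omega1 = "Field (cardSuc natLeq)"
proof -
  have "infinite (Field (cardSuc natLeq))"
    using cardSuc_finite[OF natLeq_Card_order] by (simp add: Field_natLeq)
  then have "Field (cardSuc natLeq) \<noteq> {}" by auto
  then show "\<exists>x. x \<in> Field (cardSuc natLeq)" by blast
qed

instantiation omega1 :: wellorder
begin

definition "x \<le> y \<longleftrightarrow> (Rep_omega1 x, Rep_omega1 y) \<in> cardSuc natLeq"

definition "x < y \<longleftrightarrow> x \<noteq> y \<and> (Rep_omega1 x, Rep_omega1 y) \<in> cardSuc natLeq"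

instance
proof
  have wo: "Well_order (cardSuc natLeq)" by (rule cardSuc_Well_order[OF natLeq_Card_order])
  then have r: "refl_on (Field (cardSuc natLeq)) (cardSuc natLeq)" "trans (cardSuc natLeq)"
    "antisym (cardSuc natLeq)" "total_on (Field (cardSuc natLeq)) (cardSuc natLeq)" "wf (cardSuc natLeq - Id)"
    by (auto simp: well_order_on_def linear_order_on_def partial_order_on_def preorder_on_def)
  fix x y z :: omega1
  show le_refl: "x \<le> x" using refl_onD[OF r(1) Rep_omega1] by (simp add: less_eq_omega1_def)
  show "x \<le> y \<Longrightarrow> y \<le> z \<Longrightarrow> x \<le> z" using r(2) by (auto simp: less_eq_omega1_def elim: transE)
  show anti: "x \<le> y \<Longrightarrow> y \<le> x \<Longrightarrow> x = y" for x y :: omega1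
    using antisymD[OF r(3), of "Rep_omega1 x" "Rep_omega1 y"]
    by (simp add: less_eq_omega1_def Rep_omega1_inject)
  show "x < y \<longleftrightarrow> x \<le> y \<and> \<not> y \<le> x"
    using anti[of x y] le_refl by (auto simp: less_omega1_def less_eq_omega1_def)
  show "x \<le> y \<or> y \<le> x"
    using r(4) Rep_omega1[of x] Rep_omega1[of y] le_refl
    by (cases "x = y") (auto simp: less_eq_omega1_def total_on_def Rep_omega1_inject)
  fix P :: "omega1 \<Rightarrow> bool" and a assume step: "\<And>x. (\<And>y. y < x \<Longrightarrow> P y) \<Longrightarrow> P x"
  have "wf {(x :: omega1, y). x < y}"
    by (rule wf_subset[OF wf_inv_image[OF r(5), of Rep_omega1]])
      (auto simp: inv_image_def less_omega1_def Rep_omega1_inject)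
  then show "P a" by (induction a rule: wf_induct_rule) (use step in blast)
qed

end

text \<open>A proper initial segment of a cardinal order has smaller cardinality, and what is
  smaller than the successor of \<open>natLeq\<close> is at most countable.\<close>

lemma countable_lessThan_omega1: "countable {..<\<alpha> :: omega1}"
proof -
  let ?U = "underS (cardSuc natLeq) (Rep_omega1 \<alpha>)"
  note c = cardSuc_Card_order[OF natLeq_Card_order]
  have "(card_of ?U, cardSuc natLeq) \<in> ordLess" by (rule card_of_underS[OF c Rep_omega1])
  then have "(card_of ?U, natLeq) \<in> ordLeq"
    using cardSuc_ordLeq_ordLess[OF natLeq_Card_order card_of_Card_order] by blast
  moreover have "(natLeq, card_of (UNIV :: nat set)) \<in> ordLeq"
    using card_of_Field_ordIso[OF natLeq_Card_order] by (simp add: Field_natLeq ordIso_iff_ordLeq)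
  ultimately have "(card_of ?U, card_of (UNIV :: nat set)) \<in> ordLeq" by (rule ordLeq_transitive)
  then have "countable ?U" unfolding countable_def card_of_ordLeq[symmetric] by blast
  moreover have "Rep_omega1 ` {..<\<alpha>} \<subseteq> ?U"
    by (auto simp: underS_def less_omega1_def Rep_omega1_inject)
  ultimately have "countable (Rep_omega1 ` {..<\<alpha>})" by (rule countable_subset[rotated])
  then show ?thesis by (rule countable_image_inj_on) (simp add: inj_on_def Rep_omega1_inject)
qed

lemma card_of_omega1: "(card_of (UNIV :: omega1 set), cardSuc natLeq) \<in> ordIso"
proof -
  have "bij_betw Rep_omega1 UNIV (Field (cardSuc natLeq))"
    using type_definition.Rep_range[OF type_definition_omega1]
    by (simp add: bij_betw_def inj_on_def Rep_omega1_inject)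
  then have "(card_of (UNIV :: omega1 set), card_of (Field (cardSuc natLeq))) \<in> ordIso"
    using card_of_ordIso by blast
  then show ?thesis
    using card_of_Field_ordIso[OF cardSuc_Card_order[OF natLeq_Card_order]] by (rule ordIso_transitive)
qed

theorem proposition27:
  shows "\<exists>F :: real set set.
    (card_of F, cardSuc natLeq) \<in> ordIso \<and>
    (\<forall>A\<in>F. compact A \<and> regularly_closed A \<and> t_set A) \<and>
    pairwise (\<lambda>A B. \<not> A homeomorphic B) F"
proof -
  obtain A where A: "\<And>\<alpha> :: omega1. ranked \<alpha> (A \<alpha>)"
    using ranked_exists[OF countable_lessThan_omega1] by metis
  \<comment> \<open>A homeomorphic copy of \<open>A \<alpha>\<close> has rank
    \<open>\<alpha>\<close>, and the rank is unique. This gives both the injectivity of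
    \<open>A\<close>, hence the size of the family, and the non-homeomorphism of its
    members.\<close>
  have hom: "\<alpha> = \<beta>" if h: "A \<alpha> homeomorphic A \<beta>" for \<alpha> \<beta>
  proof -
    obtain f g where "homeomorphism (A \<alpha>) (A \<beta>) f g" using h by (auto simp: homeomorphic_def)
    then have "ranked \<alpha> (A \<beta>)" by (rule ranked_homeomorphism[OF A])
    then show ?thesis using A by (rule ranked_unique)
  qed
  then have "inj A" by (metis homeomorphic_refl injI)
  then have "bij_betw A UNIV (range A)" by (simp add: bij_betw_def)
  then have "(card_of (range A), card_of (UNIV :: omega1 set)) \<in> ordIso"
    using card_of_ordIso ordIso_symmetric by blast
  then have "(card_of (range A), cardSuc natLeq) \<in> ordIso"
    using card_of_omega1 by (rule ordIso_transitive)
  moreover have "compact B \<and> regularly_closed B \<and> t_set B" if "B \<in> range A" for B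
    using that A ranked_compact ranked_regularly_closed ranked_t_set by blast
  moreover have "pairwise (\<lambda>A B. \<not> A homeomorphic B) (range A)"
    using hom by (auto simp: pairwise_def)
  ultimately show ?thesis by blast
qed

end
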